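(* Let $H=H_0+V$ where $V$ is $(\Gamma,\mathcal M)$ pseudo-ergodic, and let $E=\mathrm{Spec}(H_0)$. If $A$ is normal for every $A\in\mathcal M$, then $$\mathrm{Spec}(H)\subseteq \mathrm{Spec}(\mathcal M)+B(0,e),\qquad e=\|H_0\|.$$ If $H_0$ is normal, then $$\mathrm{Spec}(H)\subseteq E+B(0,\mu),\qquad \mu=\sup\{\|A\|:A\in\mathcal M\}.$$
   Context: $X$ is a countable set on which a group $\Gamma$ acts by permutations, $\mathcal K$ is a complex Hilbert space, and operators act on $l^2(X,\mathcal K)\cong l^2(X)\otimes\mathcal K$. For $\gamma\in\Gamma$ the unitary $U_\gamma$ is $(U_\gamma f)(x)=f(\gamma^{-1}x)$. $H_0$ is a bounded operator on $l^2(X)$ with $H_0U_\gamma=U_\gamma H_0$ for all $\gamma\in\Gamma$; the operator $H_0\otimes I$ on $l^2(X,\mathcal K)$ is also written $H_0$. $\mathcal M\subseteq\mathcal L(\mathcal K)$ (bounded operators on $\mathcal K$) is a norm closed, bounded set. A function $V:X\to\mathcal M$ is identified with the bounded operator $(Vf)(x)=V(x)f(x)$. A potential $V:X\to\mathcal M$ is $(\Gamma,\mathcal M)$ pseudo-ergodic if for every $\varepsilon>0$, every finite $F\subset X$ and every $W:F\to\mathcal M$ there exists $\gamma\in\Gamma$ such that $\|W(x)-V(\gamma x)\|<\varepsilon$ for all $x\in F$. $\mathrm{Spec}(\mathcal M)=\overline{\bigcup_{A\in\mathcal M}\mathrm{Spec}(A)}$; $B(x,r)=\{y\in\mathbf C:|x-y|\le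 r\}$ is the closed disc; sums of sets are Minkowski sums. *)

theory Defs
  imports "HOL-Analysis.Analysis" "HOL-Algebra.Group_Action"
begin

section \<open>Complex Hilbert spaces\<close>

text \<open>The norm is the one of the underlying real inner product space, so \<open>inner_eq_Re_cinner\<close>
  makes it the norm of the Hermitian form, which is conjugate-linear in its first argument.\<close>

class complex_inner = real_inner +
  fixes scaleC :: "complex \<Rightarrow> 'a \<Rightarrow> 'a" (infixr "*\<^sub>C" 75)
    and cinner :: "'a \<Rightarrow> 'a \<Rightarrow> complex"
  assumes scaleC_add_right: "c *\<^sub>C (x + y) = c *\<^sub>C x + c *\<^sub>C y"
    and scaleC_add_left: "(c + d) *\<^sub>C x = c *\<^sub>C x + d *\<^sub>C x"
    and scaleC_scaleC: "c *\<^sub>C (d *\<^sub>C x) = (c * d) *\<^sub>C x"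
    and scaleC_one: "1 *\<^sub>C x = x"
    and scaleR_scaleC: "r *\<^sub>R x = complex_of_real r *\<^sub>C x"
    and cinner_commute: "cinner x y = cnj (cinner y x)"
    and cinner_add_right: "cinner x (y + z) = cinner x y + cinner x z"
    and cinner_scaleC_right: "cinner x (c *\<^sub>C y) = c * cinner x y"
    and inner_eq_Re_cinner: "inner x y = Re (cinner x y)"

class chilbert_space = complex_inner + complete_space

instantiation complex :: chilbert_space
begin

definition scaleC_complex :: "complex \<Rightarrow> complex \<Rightarrow> complex"
  where "scaleC_complex c x = c * x"

definition cinner_complex :: "complex \<Rightarrow> complex \<Rightarrow> complex"
  where "cinner_complex x y = cnj x * y"

instance
  by standard
    (auto simp: scaleC_complex_def cinner_complex_def algebra_simps scaleR_conv_of_real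
      inner_complex_def)

end

lemma cinner_self: "cinner x x = complex_of_real ((norm x)\<^sup>2)"
  using cinner_commute[of x x] inner_eq_Re_cinner[of x x]
  by (simp add: complex_eq_iff power2_norm_eq_inner)

lemma norm_scaleC: "norm (c *\<^sub>C x) = cmod c * norm (x :: 'a::complex_inner)"
proof -
  have "cinner (c *\<^sub>C x) (c *\<^sub>C x) = c * cnj c * cinner x x"
    by (metis cinner_commute cinner_scaleC_right complex_cnj_mult mult.assoc complex_cnj_cnj)
  also have "\<dots> = complex_of_real ((cmod c * norm x)\<^sup>2)"
    by (simp add: cinner_self power_mult_distrib complex_norm_square del: of_real_power)
  finally show ?thesis
    by (simp add: cinner_self del: of_real_power)
qed

lemma norm_cinner_le: "cmod (cinner x y) \<le> norm x * norm (y :: 'a::complex_inner)"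
proof (cases "cinner x y = 0")
  case False
  define c where "c = cnj (sgn (cinner x y))"
  have c: "cmod c = 1"
    using False by (simp add: c_def norm_sgn)
  have "cinner x (c *\<^sub>C y) = cnj (sgn (cinner x y)) * cinner x y"
    by (simp add: cinner_scaleC_right c_def)
  also have "\<dots> = complex_of_real (cmod (cinner x y))"
    using False complex_norm_square[of "cinner x y"]
    by (simp add: sgn_div_norm scaleR_conv_of_real divide_simps mult.commute power2_eq_square)
  finally have "cmod (cinner x y) = inner x (c *\<^sub>C y)"
    by (simp add: inner_eq_Re_cinner)
  also have "\<dots> \<le> norm x * norm (c *\<^sub>C y)"
    by (rule norm_cauchy_schwarz)
  finally show ?thesis
    by (simp add: norm_scaleC c)
qed auto

section \<open>The space of square-summable functions\<close>

definition square_summable :: "('x \<Rightarrow> 'k::real_normed_vector) \<Rightarrow> bool"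
  where "square_summable f \<longleftrightarrow> (\<lambda>x. (norm (f x))\<^sup>2) summable_on UNIV"

typedef (overloaded) ('x, 'k::chilbert_space) ell2 = "{f :: 'x \<Rightarrow> 'k. square_summable f}"
  morphisms ell2_apply Abs_ell2
  by (rule exI[of _ "\<lambda>_. 0"]) (simp add: square_summable_def)

setup_lifting type_definition_ell2

lemma ell2_eqI: "(\<And>x. ell2_apply f x = ell2_apply g x) \<Longrightarrow> f = g"
  by (simp add: ell2_apply_inject[symmetric] fun_eq_iff)

lemma square_summable_bound:
  fixes f g :: "_ \<Rightarrow> 'k::real_normed_vector"
  assumes "\<And>x. (norm (f x))\<^sup>2 \<le> c * (norm (g x))\<^sup>2" "square_summable g"
  shows "square_summable f"
  unfolding square_summable_def
  by (rule summable_on_comparison_test[of "\<lambda>x. c * (norm (g x))\<^sup>2"])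
    (use assms in \<open>auto intro: summable_on_cmult_right simp: square_summable_def\<close>)

lemma square_summable_add:
  fixes f g :: "_ \<Rightarrow> 'k::real_normed_vector"
  assumes "square_summable f" "square_summable g"
  shows "square_summable (\<lambda>x. f x + g x)"
  unfolding square_summable_def
proof (rule summable_on_comparison_test)
  show "(\<lambda>x. 2 * (norm (f x))\<^sup>2 + 2 * (norm (g x))\<^sup>2) summable_on UNIV"
    using assms by (intro summable_on_add summable_on_cmult_right) (auto simp: square_summable_def)
  show "(norm (f x + g x))\<^sup>2 \<le> 2 * (norm (f x))\<^sup>2 + 2 * (norm (g x))\<^sup>2" for x
  proof -
    have "(norm (f x + g x))\<^sup>2 \<le> (norm (f x) + norm (g x))\<^sup>2"
      by (intro power_mono norm_triangle_ineq) auto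
    also have "\<dots> \<le> 2 * (norm (f x))\<^sup>2 + 2 * (norm (g x))\<^sup>2"
      using sum_squares_bound[of "norm (f x)" "norm (g x)"] by (simp add: power2_sum)
    finally show ?thesis .
  qed
qed auto

lemma square_summable_scaleR:
  "square_summable f \<Longrightarrow> square_summable (\<lambda>x. r *\<^sub>R f x)"
  by (rule square_summable_bound[of _ "r\<^sup>2"]) (auto simp: power_mult_distrib)

lemma square_summable_scaleC:
  "square_summable f \<Longrightarrow> square_summable (\<lambda>x. c *\<^sub>C (f x :: 'k::complex_inner))"
  by (rule square_summable_bound[of _ "(cmod c)\<^sup>2"]) (auto simp: power_mult_distrib norm_scaleC)

lemma square_summable_cinner:
  fixes f g :: "_ \<Rightarrow> 'k::complex_inner"
  assumes "square_summable f" "square_summable g"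
  shows "(\<lambda>x. cinner (f x) (g x)) summable_on UNIV"
proof (rule abs_summable_summable, rule summable_on_comparison_test)
  show "(\<lambda>x. (norm (f x))\<^sup>2 + (norm (g x))\<^sup>2) summable_on UNIV"
    using assms by (intro summable_on_add) (auto simp: square_summable_def)
  show "cmod (cinner (f x) (g x)) \<le> (norm (f x))\<^sup>2 + (norm (g x))\<^sup>2" for x
    using norm_cinner_le[of "f x" "g x"] sum_squares_bound[of "norm (f x)" "norm (g x)"]
      mult_nonneg_nonneg[OF norm_ge_zero[of "f x"] norm_ge_zero[of "g x"]] by linarith
qed auto

lemma has_sum_Re: "(f has_sum s) A \<Longrightarrow> ((\<lambda>x. Re (f x)) has_sum Re s) A"
  using has_sum_bounded_linear[OF bounded_linear_Re] by blast

lemma has_sum_inner_ell2: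
  fixes f g :: "_ \<Rightarrow> 'k::complex_inner"
  assumes "square_summable f" "square_summable g"
  shows "((\<lambda>x. inner (f x) (g x)) has_sum Re (\<Sum>\<^sub>\<infinity>x. cinner (f x) (g x))) UNIV"
  using has_sum_Re[OF has_sum_infsum[OF square_summable_cinner[OF assms]]]
  by (simp add: inner_eq_Re_cinner)

instantiation ell2 :: (type, chilbert_space) complex_inner
begin

lift_definition zero_ell2 :: "('a, 'b) ell2" is "\<lambda>_. 0"
  by (simp add: square_summable_def)

lift_definition plus_ell2 :: "('a, 'b) ell2 \<Rightarrow> ('a, 'b) ell2 \<Rightarrow> ('a, 'b) ell2"
  is "\<lambda>f g x. f x + g x"
  by (rule square_summable_add)

lift_definition uminus_ell2 :: "('a, 'b) ell2 \<Rightarrow> ('a, 'b) ell2" is "\<lambda>f x. - f x"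
  by (simp add: square_summable_def)

lift_definition minus_ell2 :: "('a, 'b) ell2 \<Rightarrow> ('a, 'b) ell2 \<Rightarrow> ('a, 'b) ell2"
  is "\<lambda>f g x. f x - g x"
  subgoal for f g
    using square_summable_add[of f "\<lambda>x. - g x"] by (simp add: square_summable_def)
  done

lift_definition scaleR_ell2 :: "real \<Rightarrow> ('a, 'b) ell2 \<Rightarrow> ('a, 'b) ell2"
  is "\<lambda>r f x. r *\<^sub>R f x"
  by (rule square_summable_scaleR)

lift_definition scaleC_ell2 :: "complex \<Rightarrow> ('a, 'b) ell2 \<Rightarrow> ('a, 'b) ell2"
  is "\<lambda>c f x. c *\<^sub>C f x"
  by (rule square_summable_scaleC)

lift_definition cinner_ell2 :: "('a, 'b) ell2 \<Rightarrow> ('a, 'b) ell2 \<Rightarrow> complex"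
  is "\<lambda>f g. \<Sum>\<^sub>\<infinity>x. cinner (f x) (g x)" .

definition inner_ell2 :: "('a, 'b) ell2 \<Rightarrow> ('a, 'b) ell2 \<Rightarrow> real"
  where "inner_ell2 f g = Re (cinner f g)"

definition norm_ell2 :: "('a, 'b) ell2 \<Rightarrow> real"
  where "norm_ell2 f = sqrt (inner f f)"

definition dist_ell2 :: "('a, 'b) ell2 \<Rightarrow> ('a, 'b) ell2 \<Rightarrow> real"
  where "dist_ell2 f g = norm (f - g)"

definition sgn_ell2 :: "('a, 'b) ell2 \<Rightarrow> ('a, 'b) ell2"
  where "sgn_ell2 f = inverse (norm f) *\<^sub>R f"

definition uniformity_ell2 :: "(('a, 'b) ell2 \<times> ('a, 'b) ell2) filter"
  where "uniformity_ell2 = (INF e\<in>{0 <..}. principal {(x, y). dist x y < e})"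

definition open_ell2 :: "('a, 'b) ell2 set \<Rightarrow> bool"
  where "open_ell2 S \<longleftrightarrow> (\<forall>x\<in>S. \<forall>\<^sub>F (x', y) in uniformity. x' = x \<longrightarrow> y \<in> S)"

instance
proof
  fix f g h :: "('a, 'b) ell2" and r s :: real and c d :: complex
  show "f + g + h = f + (g + h)" "f + g = g + f" "0 + f = f" "- f + f = 0" "f - g = f + - g"
    by (transfer; simp add: algebra_simps)+
  show "r *\<^sub>R (f + g) = r *\<^sub>R f + r *\<^sub>R g" "(r + s) *\<^sub>R f = r *\<^sub>R f + s *\<^sub>R f"
    "r *\<^sub>R s *\<^sub>R f = (r * s) *\<^sub>R f" "1 *\<^sub>R f = f"
    by (transfer; simp add: algebra_simps)+
  show "c *\<^sub>C (f + g) = c *\<^sub>C f + c *\<^sub>C g" "(c + d) *\<^sub>C f = c *\<^sub>C f + d *\<^sub>C f"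
    "c *\<^sub>C d *\<^sub>C f = (c * d) *\<^sub>C f" "1 *\<^sub>C f = f" "r *\<^sub>R f = complex_of_real r *\<^sub>C f"
    by (transfer; simp add: scaleC_add_right scaleC_add_left scaleC_scaleC scaleC_one
        scaleR_scaleC)+
  show "dist f g = norm (f - g)"
    by (rule dist_ell2_def)
  show "sgn f = inverse (norm f) *\<^sub>R f"
    by (rule sgn_ell2_def)
  show "uniformity = (INF e\<in>{0 <..}. principal {(x, y). dist x (y :: ('a, 'b) ell2) < e})"
    by (rule uniformity_ell2_def)
  show "open S = (\<forall>x\<in>S. \<forall>\<^sub>F (x', y) in uniformity. x' = x \<longrightarrow> y \<in> S)"
    for S :: "('a, 'b) ell2 set"
    by (rule open_ell2_def)
  show comm: "cinner f g = cnj (cinner g f)" for f g :: "('a, 'b) ell2"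
    by transfer (subst infsum_cnj[symmetric], metis cinner_commute)
  show add: "cinner f (g + h) = cinner f g + cinner f h" for f g h :: "('a, 'b) ell2"
    by transfer (simp add: cinner_add_right infsum_add square_summable_cinner)
  show scale: "cinner f (c *\<^sub>C g) = c * cinner f g" for f g :: "('a, 'b) ell2" and c
    by transfer (simp add: cinner_scaleC_right infsum_cmult_right')
  show inner_Re: "inner f g = Re (cinner f g)" for f g :: "('a, 'b) ell2"
    by (rule inner_ell2_def)
  show "inner f g = inner g f"
    by (metis comm inner_Re cnj.sel(1))
  show "inner (f + g) h = inner f h + inner g h"
    by (metis add comm inner_Re cnj.sel(1) plus_complex.sel(1))
  show "inner (r *\<^sub>R f) g = r * inner f g"
  proof -
    have "r *\<^sub>R f = complex_of_real r *\<^sub>C f"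
      by transfer (simp add: scaleR_scaleC)
    then show ?thesis
      by (metis scale comm inner_Re cnj.sel(1) Re_complex_of_real Im_complex_of_real
          times_complex.sel(1) mult_zero_left diff_zero)
  qed
  have sq: "((\<lambda>x. (norm (ell2_apply f x))\<^sup>2) has_sum inner f f) UNIV"
    unfolding inner_ell2_def cinner_ell2.rep_eq power2_norm_eq_inner
    by (rule has_sum_inner_ell2) (use ell2_apply in auto)
  then show nonneg: "0 \<le> inner f f"
    by (rule has_sum_nonneg) auto
  show "inner f f = 0 \<longleftrightarrow> f = 0"
  proof
    assume "inner f f = 0"
    then have "(norm (ell2_apply f x))\<^sup>2 = 0" for x
      using nonneg_infsum_le_0D[of "\<lambda>x. (norm (ell2_apply f x))\<^sup>2" UNIV x] sq
      by (auto simp: infsumI has_sum_imp_summable)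
    then show "f = 0"
      by (intro ell2_eqI) (simp add: zero_ell2.rep_eq)
  next
    assume "f = 0"
    then show "inner f f = 0"
      using infsumI[OF sq] by (simp add: zero_ell2.rep_eq)
  qed
  show "norm f = sqrt (inner f f)"
    by (rule norm_ell2_def)
qed

end

lemma norm_ell2_has_sum: "((\<lambda>x. (norm (ell2_apply f x))\<^sup>2) has_sum (norm f)\<^sup>2) UNIV"
  unfolding power2_norm_eq_inner inner_ell2_def cinner_ell2.rep_eq
  by (rule has_sum_inner_ell2) (use ell2_apply in auto)

lemma norm_ell2_eq: "norm f = sqrt (\<Sum>\<^sub>\<infinity>x. (norm (ell2_apply f x))\<^sup>2)"
  by (simp add: infsumI[OF norm_ell2_has_sum])

lemma norm_ell2_finite_le: "finite F \<Longrightarrow> (\<Sum>x\<in>F. (norm (ell2_apply f x))\<^sup>2) \<le> (norm f)\<^sup>2"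
  by (rule finite_sum_le_has_sum[OF norm_ell2_has_sum]) auto

lemma norm_ell2_apply_le: "norm (ell2_apply f x) \<le> norm f"
  by (rule power2_le_imp_le) (use norm_ell2_finite_le[of "{x}" f] in auto)

lemma ell2_boundI:
  assumes "\<And>F. finite F \<Longrightarrow> (\<Sum>x\<in>F. (norm (f x))\<^sup>2) \<le> b\<^sup>2" "0 \<le> b"
  shows "square_summable f" "norm (Abs_ell2 f) \<le> b"
proof -
  show *: "square_summable f"
    unfolding square_summable_def
    by (rule nonneg_bdd_above_summable_on) (use assms(1) in \<open>auto intro!: bdd_aboveI[of _ "b\<^sup>2"]\<close>)
  have "(\<Sum>\<^sub>\<infinity>x. (norm (f x))\<^sup>2) \<le> b\<^sup>2"
    by (rule infsum_le_finite_sums) (use * assms in \<open>auto simp: square_summable_def\<close>)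
  then show "norm (Abs_ell2 f) \<le> b"
    using * assms(2) by (simp add: norm_ell2_eq Abs_ell2_inverse real_le_lsqrt infsum_nonneg)
qed

instance ell2 :: (type, chilbert_space) chilbert_space
proof
  fix X :: "nat \<Rightarrow> ('a, 'b) ell2"
  assume X: "Cauchy X"
  have "Cauchy (\<lambda>n. ell2_apply (X n) x)" for x
  proof (rule metric_CauchyI)
    fix e :: real assume "0 < e"
    then obtain N where N: "\<And>m n. m \<ge> N \<Longrightarrow> n \<ge> N \<Longrightarrow> dist (X m) (X n) < e"
      using metric_CauchyD[OF X] by blast
    have le: "dist (ell2_apply (X m) x) (ell2_apply (X n) x) \<le> dist (X m) (X n)" for m n
      using norm_ell2_apply_le[of "X m - X n" x] by (simp add: dist_norm minus_ell2.rep_eq)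
    show "\<exists>N. \<forall>m\<ge>N. \<forall>n\<ge>N. dist (ell2_apply (X m) x) (ell2_apply (X n) x) < e"
      by (intro exI[of _ N] allI impI le_less_trans[OF le N])
  qed
  then have "\<forall>x. \<exists>l. (\<lambda>n. ell2_apply (X n) x) \<longlonglongrightarrow> l"
    by (simp flip: convergent_def add: Cauchy_convergent)
  then obtain g where g: "\<And>x. (\<lambda>n. ell2_apply (X n) x) \<longlonglongrightarrow> g x"
    by metis
  have key: "square_summable (\<lambda>x. ell2_apply (X n) x - g x)
      \<and> norm (Abs_ell2 (\<lambda>x. ell2_apply (X n) x - g x)) \<le> e"
    if "0 < e" and N: "\<And>m n. m \<ge> N \<Longrightarrow> n \<ge> N \<Longrightarrow> dist (X m) (X n) < e" and "n \<ge> N" for e N n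
  proof -
    have "(\<Sum>x\<in>F. (norm (ell2_apply (X n) x - g x))\<^sup>2) \<le> e\<^sup>2" if "finite F" for F
    proof (rule LIMSEQ_le_const2)
      show "(\<lambda>m. \<Sum>x\<in>F. (norm (ell2_apply (X n) x - ell2_apply (X m) x))\<^sup>2)
          \<longlonglongrightarrow> (\<Sum>x\<in>F. (norm (ell2_apply (X n) x - g x))\<^sup>2)"
        by (intro tendsto_intros g)
      have "(\<Sum>x\<in>F. (norm (ell2_apply (X n) x - ell2_apply (X m) x))\<^sup>2) \<le> e\<^sup>2" if "m \<ge> N" for m
      proof -
        have "(\<Sum>x\<in>F. (norm (ell2_apply (X n) x - ell2_apply (X m) x))\<^sup>2) \<le> (norm (X n - X m))\<^sup>2"
          using norm_ell2_finite_le[OF \<open>finite F\<close>, of "X n - X m"] by (simp add: minus_ell2.rep_eq)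
        also have "\<dots> \<le> e\<^sup>2"
          using N[OF \<open>n \<ge> N\<close> that] by (intro power_mono) (auto simp: dist_norm)
        finally show ?thesis .
      qed
      then show "\<exists>N. \<forall>m\<ge>N. (\<Sum>x\<in>F. (norm (ell2_apply (X n) x - ell2_apply (X m) x))\<^sup>2) \<le> e\<^sup>2"
        by blast
    qed
    from ell2_boundI[OF this] \<open>0 < e\<close> show ?thesis
      by simp
  qed
  obtain N0 where N0: "\<And>m n. m \<ge> N0 \<Longrightarrow> n \<ge> N0 \<Longrightarrow> dist (X m) (X n) < 1"
    using metric_CauchyD[OF X, of 1] by auto
  have "square_summable (\<lambda>x. ell2_apply (X N0) x - g x)"
    using key[OF _ N0] by simp
  moreover have "square_summable (ell2_apply (X N0))"
    using ell2_apply by blast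
  ultimately have "square_summable (\<lambda>x. ell2_apply (X N0) x + - 1 *\<^sub>R (ell2_apply (X N0) x - g x))"
    by (intro square_summable_add square_summable_scaleR)
  then have g_sq: "square_summable g"
    by simp
  have diff: "Abs_ell2 (\<lambda>x. ell2_apply (X n) x - g x) = X n - Abs_ell2 g" for n
  proof -
    have "ell2_apply (X n - Abs_ell2 g) = (\<lambda>x. ell2_apply (X n) x - g x)"
      by (simp add: minus_ell2.rep_eq Abs_ell2_inverse g_sq)
    then show ?thesis
      by (metis ell2_apply_inverse)
  qed
  have "X \<longlonglongrightarrow> Abs_ell2 g"
  proof (rule metric_LIMSEQ_I)
    fix r :: real assume "0 < r"
    then obtain N where N: "\<And>m n. m \<ge> N \<Longrightarrow> n \<ge> N \<Longrightarrow> dist (X m) (X n) < r / 2"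
      using metric_CauchyD[OF X, of "r / 2"] by auto
    have "dist (X n) (Abs_ell2 g) < r" if "n \<ge> N" for n
      using key[OF _ N that] \<open>0 < r\<close> by (simp add: diff dist_norm)
    then show "\<exists>N. \<forall>n\<ge>N. dist (X n) (Abs_ell2 g) < r"
      by blast
  qed
  then show "convergent X"
    by (auto simp: convergent_def)
qed

section \<open>Bounded operators\<close>

text \<open>Elements of \<open>'a \<Rightarrow>\<^sub>L 'a\<close> are bounded and real-linear; \<open>clin_ops\<close> is the algebra
  \<open>L('a)\<close> of bounded complex-linear operators, a closed subset carrying the operator norm.\<close>

definition clin_ops :: "('a::complex_inner \<Rightarrow>\<^sub>L 'a) set"
  where "clin_ops = {T :: 'a \<Rightarrow>\<^sub>L 'a. \<forall>c x. T (c *\<^sub>C x) = c *\<^sub>C T x}"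

definition Spec :: "('a::complex_inner \<Rightarrow>\<^sub>L 'a) \<Rightarrow> complex set"
  where "Spec T = {z. \<not> (\<exists>S\<in>clin_ops. (\<forall>x. S (T x - z *\<^sub>C x) = x) \<and>
                                       (\<forall>x. T (S x) - z *\<^sub>C S x = x))}"

definition Spec_set :: "('a::complex_inner \<Rightarrow>\<^sub>L 'a) set \<Rightarrow> complex set"
  where "Spec_set M = closure (\<Union>A\<in>M. Spec A)"

definition cadjoint :: "('a::chilbert_space \<Rightarrow>\<^sub>L 'a) \<Rightarrow> 'a \<Rightarrow>\<^sub>L 'a"
  where "cadjoint T = (THE S :: 'a \<Rightarrow>\<^sub>L 'a. \<forall>x y. cinner (T x) y = cinner x (S y))"

definition normal_op :: "('a::chilbert_space \<Rightarrow>\<^sub>L 'a) \<Rightarrow> bool"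
  where "normal_op T \<longleftrightarrow> T o\<^sub>L cadjoint T = cadjoint T o\<^sub>L T"

section \<open>Operators on the square-summable functions\<close>

lift_definition tensor_ell2 :: "('x, complex) ell2 \<Rightarrow> 'k::chilbert_space \<Rightarrow> ('x, 'k) ell2"
  is "\<lambda>f k x. f x *\<^sub>C k"
  subgoal for f k
    by (auto simp: square_summable_def norm_scaleC power_mult_distrib
        intro: summable_on_cmult_left)
  done

text \<open>The operator \<open>T \<otimes> I\<close>, characterised by its action on elementary tensors (whose span is
  dense).\<close>

definition ampliation ::
    "(('x, complex) ell2 \<Rightarrow>\<^sub>L ('x, complex) ell2) \<Rightarrow> ('x, 'k::chilbert_space) ell2 \<Rightarrow>\<^sub>L ('x, 'k) ell2"
  where "ampliation T =
    (THE S :: ('x, 'k) ell2 \<Rightarrow>\<^sub>L ('x, 'k) ell2. S \<in> clin_ops \<and> (\<forall>f k. S (tensor_ell2 f k) = tensor_ell2 (T f) k))"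

text \<open>The following two operators are bounded, hence not junk values, as soon as \<open>p\<close> is a
  bijection and \<open>V\<close> is bounded; see \<open>transl_apply\<close> and \<open>mult_op_apply\<close>.\<close>

definition transl :: "('x \<Rightarrow> 'x) \<Rightarrow> ('x, 'k::chilbert_space) ell2 \<Rightarrow>\<^sub>L ('x, 'k) ell2"
  where "transl p = Blinfun (\<lambda>f. Abs_ell2 (\<lambda>x. ell2_apply f (p x)))"

definition mult_op ::
    "('x \<Rightarrow> 'k::chilbert_space \<Rightarrow>\<^sub>L 'k) \<Rightarrow> ('x, 'k) ell2 \<Rightarrow>\<^sub>L ('x, 'k) ell2"
  where "mult_op V = Blinfun (\<lambda>f. Abs_ell2 (\<lambda>x. V x (ell2_apply f x)))"

lemma Blinfun_ell2_apply:
  fixes T :: "('x \<Rightarrow> 'k::chilbert_space) \<Rightarrow> 'x \<Rightarrow> 'k"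
  assumes bound: "\<And>f F. finite F \<Longrightarrow>
      (\<Sum>x\<in>F. (norm (T (ell2_apply f) x))\<^sup>2) \<le> (b * norm f)\<^sup>2" and "0 \<le> b"
    and add: "\<And>f g. T (\<lambda>x. f x + g x) = (\<lambda>x. T f x + T g x)"
    and scale: "\<And>f r. T (\<lambda>x. r *\<^sub>R f x) = (\<lambda>x. r *\<^sub>R T f x)"
  shows "ell2_apply (blinfun_apply (Blinfun (\<lambda>f. Abs_ell2 (T (ell2_apply f)))) f) x
    = T (ell2_apply f) x"
proof -
  have nonneg: "0 \<le> b * norm f" for f :: "('x, 'k) ell2"
    using \<open>0 \<le> b\<close> by simp
  note sq = ell2_boundI(1)[OF bound nonneg] and le = ell2_boundI(2)[OF bound nonneg]
  have "bounded_linear (\<lambda>f. Abs_ell2 (T (ell2_apply f)))"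
  proof (rule bounded_linear_intro)
    show "Abs_ell2 (T (ell2_apply (f + g))) = Abs_ell2 (T (ell2_apply f)) + Abs_ell2 (T (ell2_apply g))"
      for f g
      by (rule ell2_eqI)
        (use sq[of "f + g"] sq[of f] sq[of g] in
          \<open>simp add: Abs_ell2_inverse plus_ell2.rep_eq add\<close>)
    show "Abs_ell2 (T (ell2_apply (r *\<^sub>R f))) = r *\<^sub>R Abs_ell2 (T (ell2_apply f))" for r f
      by (rule ell2_eqI)
        (use sq[of "r *\<^sub>R f"] sq[of f] in \<open>simp add: Abs_ell2_inverse scaleR_ell2.rep_eq scale\<close>)
    show "norm (Abs_ell2 (T (ell2_apply f))) \<le> norm f * b" for f
      using le[of f] by (simp add: mult.commute)
  qed
  then show ?thesis
    by (simp add: bounded_linear_Blinfun_apply Abs_ell2_inverse sq)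
qed

lemma transl_apply:
  fixes f :: "('x, 'k::chilbert_space) ell2"
  assumes "bij p"
  shows "ell2_apply (transl p f) x = ell2_apply f (p x)"
  unfolding transl_def
proof (rule Blinfun_ell2_apply[of "\<lambda>f x. f (p x)" 1])
  fix f :: "('x, 'k) ell2" and F :: "'x set"
  assume "finite F"
  have "(\<Sum>x\<in>F. (norm (ell2_apply f (p x)))\<^sup>2) = (\<Sum>x\<in>p ` F. (norm (ell2_apply f x))\<^sup>2)"
    using assms by (subst sum.reindex) (auto simp: bij_def inj_on_def)
  also have "\<dots> \<le> (norm f)\<^sup>2"
    using \<open>finite F\<close> by (intro norm_ell2_finite_le) auto
  finally show "(\<Sum>x\<in>F. (norm (ell2_apply f (p x)))\<^sup>2) \<le> (1 * norm f)\<^sup>2"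
    by simp
qed auto

lemma mult_op_apply:
  fixes f :: "('x, 'k::chilbert_space) ell2"
  assumes "bounded (range V)"
  shows "ell2_apply (mult_op V f) x = V x (ell2_apply f x)"
  unfolding mult_op_def
proof -
  obtain b where "0 < b" and b: "\<And>x. norm (V x) \<le> b"
    using assms by (auto simp: bounded_pos)
  show "ell2_apply (Blinfun (\<lambda>f. Abs_ell2 (\<lambda>x. V x (ell2_apply f x))) f) x = V x (ell2_apply f x)"
  proof (rule Blinfun_ell2_apply[of "\<lambda>f x. V x (f x)" b])
    fix f :: "('x, 'k) ell2" and F :: "'x set"
    assume "finite F"
    have "(\<Sum>x\<in>F. (norm (V x (ell2_apply f x)))\<^sup>2) \<le> (\<Sum>x\<in>F. (b * norm (ell2_apply f x))\<^sup>2)"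
      by (intro sum_mono power_mono order_trans[OF norm_blinfun] mult_right_mono b) auto
    also have "\<dots> = b\<^sup>2 * (\<Sum>x\<in>F. (norm (ell2_apply f x))\<^sup>2)"
      by (simp add: power_mult_distrib sum_distrib_left)
    also have "\<dots> \<le> (b * norm f)\<^sup>2"
      using norm_ell2_finite_le[OF \<open>finite F\<close>, of f] by (simp add: power_mult_distrib mult_left_mono)
    finally show "(\<Sum>x\<in>F. (norm (V x (ell2_apply f x)))\<^sup>2) \<le> (b * norm f)\<^sup>2" .
  qed (use \<open>0 < b\<close> in \<open>auto simp: blinfun.add_right blinfun.scaleR_right\<close>)
qed

definition translation ::
    "('g, 'm) monoid_scheme \<Rightarrow> ('g \<Rightarrow> 'x \<Rightarrow> 'x) \<Rightarrow> 'g \<Rightarrow> ('x, 'k::chilbert_space) ell2 \<Rightarrow>\<^sub>L ('x, 'k) ell2"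
  where "translation G \<phi> g = transl (\<phi> (inv\<^bsub>G\<^esub> g))"

definition pseudo_ergodic ::
    "('g, 'm) monoid_scheme \<Rightarrow> ('g \<Rightarrow> 'x \<Rightarrow> 'x) \<Rightarrow> ('k::chilbert_space \<Rightarrow>\<^sub>L 'k) set
      \<Rightarrow> ('x \<Rightarrow> 'k \<Rightarrow>\<^sub>L 'k) \<Rightarrow> bool"
  where "pseudo_ergodic G \<phi> M V \<longleftrightarrow> range V \<subseteq> M \<and>
    (\<forall>\<epsilon>>0. \<forall>F W. finite F \<longrightarrow> W ` F \<subseteq> M \<longrightarrow>
      (\<exists>g\<in>carrier G. \<forall>x\<in>F. norm (W x - V (\<phi> g x)) < \<epsilon>))"

end

theory Submission
  imports Defs
begin

text \<open>Both inclusions come from one perturbation argument. Write \<open>H - z = (T - z) + B\<close>, where \<open>T\<close>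
  is the summand made of normal operators and \<open>B\<close> the other one. If the distance \<open>d\<close> from \<open>z\<close> to the
  relevant spectrum exceeds \<open>\<parallel>B\<parallel>\<close>, then the resolvent of \<open>T\<close> at \<open>z\<close> has norm at most \<open>1 / d\<close>, its
  product with \<open>B\<close> is a strict contraction, and a Neumann series (\<open>op_inverse_perturb\<close>) inverts
  \<open>H - z\<close>.

  In the first inclusion \<open>T = V\<close> and \<open>B = H\<^sub>0 \<otimes> I\<close>: the inverse of \<open>V - z\<close> is the multiplication by
  the inverses of \<open>V x - z\<close> (\<open>op_inverse_mult_op\<close>), which are bounded uniformly in \<open>x\<close>. In the second
  one \<open>T = H\<^sub>0 \<otimes> I\<close> and \<open>B = V\<close>: the inverse of \<open>T - z\<close> is \<open>(H\<^sub>0 - z)\<inverse> \<otimes> I\<close>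
  (\<open>op_inverse_ampliation\<close>). Tensoring with \<open>I\<close> does not increase the norm (\<open>ampliation\<close>); this
  bounds \<open>H\<^sub>0 \<otimes> I\<close> in the first case and \<open>(H\<^sub>0 - z)\<inverse> \<otimes> I\<close> in the second.

  The analytic core is \<open>norm_resolvent_le\<close>, the bound \<open>1 / d\<close> for the resolvent of a normal operator.
  Two facts give it. First, a normal operator satisfies \<open>\<parallel>A x\<parallel>\<^sup>2 \<le> \<parallel>A A x\<parallel> \<parallel>x\<parallel>\<close>, an inequality
  that is inherited by scalar multiples, inverses and squares and forces \<open>\<parallel>A\<^sup>n\<parallel> = \<parallel>A\<parallel>\<^sup>n\<close> for
  \<open>n = 2\<^sup>k\<close>. Secondly, an operator \<open>P\<close> with \<open>\<parallel>P\<parallel> \<le> 1\<close> such that \<open>1 - w P\<close> is invertible for all \<open>w\<close>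
  in the closed unit disc has a power \<open>P\<^sup>n\<close>, again with \<open>n = 2\<^sup>k\<close>, of norm less than one
  (\<open>dyadic_power_contracts\<close>). This is Rickart's averaging argument, driven by the uniform
  continuity of the resolvent on the disc.

  Adjoints exist by the Riesz representation theorem. They enter through normality and through the
  construction of \<open>T \<otimes> I\<close>, where the matrix rows of \<open>T\<close> are conjugates of values of \<open>T*\<close>.\<close>

section \<open>Complex inner product spaces and adjoints\<close>

instance chilbert_space \<subseteq> banach ..

lemma cinner_scaleC_left: "cinner (c *\<^sub>C x) y = cnj c * cinner x (y :: 'a::complex_inner)"
  by (metis cinner_scaleC_right cinner_commute complex_cnj_mult)

lemma scaleR_scaleC_commute: "r *\<^sub>R c *\<^sub>C x = c *\<^sub>C r *\<^sub>R (x :: 'a::complex_inner)"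
  by (simp add: scaleR_scaleC scaleC_scaleC mult.commute)

lemma bounded_linear_scaleC_right: "bounded_linear (\<lambda>x :: 'a::complex_inner. c *\<^sub>C x)"
  by (rule bounded_linear_intro[of _ "cmod c"])
    (simp_all add: scaleC_add_right scaleR_scaleC_commute norm_scaleC)

lemma bounded_linear_scaleC_left: "bounded_linear (\<lambda>c. c *\<^sub>C (x :: 'a::complex_inner))"
  by (rule bounded_linear_intro[of _ "norm x"])
    (simp_all add: scaleC_add_left scaleR_scaleC scaleC_scaleC norm_scaleC scaleC_complex_def)

lemma bounded_linear_cinner_right: "bounded_linear (cinner (x :: 'a::complex_inner))"
  by (rule bounded_linear_intro[of _ "norm x"])
    (simp_all add: cinner_add_right scaleR_scaleC[where ?'a = 'a] cinner_scaleC_right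
      scaleR_conv_of_real norm_cinner_le mult.commute[of _ "norm x"])

lemmas scaleC_diff_right = linear_diff[OF bounded_linear.linear[OF bounded_linear_scaleC_right]]
lemmas scaleC_minus_right = linear_neg[OF bounded_linear.linear[OF bounded_linear_scaleC_right]]
lemmas scaleC_zero_left [simp] = linear_0[OF bounded_linear.linear[OF bounded_linear_scaleC_left]]
lemmas scaleC_diff_left = linear_diff[OF bounded_linear.linear[OF bounded_linear_scaleC_left]]
lemmas scaleC_minus_left = linear_neg[OF bounded_linear.linear[OF bounded_linear_scaleC_left]]
lemmas cinner_diff_right = linear_diff[OF bounded_linear.linear[OF bounded_linear_cinner_right]]
lemmas cinner_sum_right = linear_sum[OF bounded_linear.linear[OF bounded_linear_cinner_right]]

lemma cinner_diff_left: "cinner (x - y) z = cinner x z - cinner y (z :: 'a::complex_inner)"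
  by (metis cinner_diff_right cinner_commute complex_cnj_diff)

lemma cinner_eqI:
  fixes x y :: "'a::complex_inner"
  assumes "\<And>z. cinner z x = cinner z y"
  shows "x = y"
proof -
  have "cinner (x - y) (x - y) = 0"
    by (simp add: cinner_diff_right assms)
  then show ?thesis
    by (simp add: cinner_self)
qed

text \<open>Riesz representation. The representing vector is the minimiser of
  \<open>J x = \<parallel>x\<parallel>\<^sup>2 - 2 \<phi> x\<close>: the parallelogram law makes minimising sequences Cauchy, and the first
  variation of \<open>J\<close> at its minimiser is the claimed identity.\<close>

lemma Riesz_representation:
  fixes \<phi> :: "'a::{real_inner, complete_space} \<Rightarrow> real"
  assumes "bounded_linear \<phi>"
  shows "\<exists>v. \<forall>x. \<phi> x = inner v x"
proof -
  interpret \<phi>: bounded_linear \<phi> by fact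
  define J where "J x = (norm x)\<^sup>2 - 2 * \<phi> x" for x
  obtain C where C: "\<And>x. norm (\<phi> x) \<le> norm x * C"
    using \<phi>.bounded by blast
  have J_bound: "- C\<^sup>2 \<le> J x" for x
  proof -
    have "\<phi> x \<le> norm x * C"
      using C[of x] by simp
    then show ?thesis
      using sum_squares_bound[of "norm x" C] unfolding J_def by simp
  qed
  then have bdd: "bdd_below (range J)"
    by (intro bdd_belowI[of _ "- C\<^sup>2"]) auto
  define m where "m = Inf (range J)"
  have m_le: "m \<le> J x" for x
    unfolding m_def by (rule cINF_lower[OF bdd]) simp
  have "\<exists>x. J x < m + 1 / Suc n" for n
  proof -
    have "Inf (range J) < m + 1 / Suc n"
      by (simp add: m_def)
    then show ?thesis
      using cInf_lessD[of "range J"] by blast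
  qed
  then obtain X where X: "\<And>n. J (X n) < m + 1 / Suc n"
    by metis
  have par: "(norm (x - y))\<^sup>2 \<le> 2 * (J x - m) + 2 * (J y - m)" for x y
  proof -
    have "(norm (x - y))\<^sup>2 = 2 * J x + 2 * J y - 4 * J ((1/2) *\<^sub>R (x + y))"
      by (simp add: J_def power2_norm_eq_inner inner_add_left inner_add_right inner_diff_left
          inner_diff_right \<phi>.scaleR \<phi>.add inner_commute algebra_simps)
    then show ?thesis
      using m_le[of "(1/2) *\<^sub>R (x + y)"] by simp
  qed
  have "Cauchy X"
  proof (rule metric_CauchyI)
    fix e :: real assume "0 < e"
    then obtain N where N: "1 / Suc N < e\<^sup>2 / 4"
      using nat_approx_posE[of "e\<^sup>2 / 4"] by auto
    have "dist (X i) (X j) < e" if "i \<ge> N" "j \<ge> N" for i j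
    proof (rule power2_less_imp_less)
      have "1 / Suc i \<le> 1 / real (Suc N)" "1 / Suc j \<le> 1 / real (Suc N)"
        using that by (auto intro: divide_left_mono)
      then show "(dist (X i) (X j))\<^sup>2 < e\<^sup>2"
        using par[of "X i" "X j"] X[of i] X[of j] N unfolding dist_norm by argo
    qed (use \<open>0 < e\<close> in simp)
    then show "\<exists>N. \<forall>i\<ge>N. \<forall>j\<ge>N. dist (X i) (X j) < e"
      by blast
  qed
  then obtain v where v: "X \<longlonglongrightarrow> v"
    using Cauchy_convergent convergent_def by blast
  have "(\<lambda>n. J (X n)) \<longlonglongrightarrow> J v"
    unfolding J_def by (intro tendsto_intros v \<phi>.tendsto)
  moreover have "(\<lambda>n. m + 1 / Suc n) \<longlonglongrightarrow> m + 0"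
    using LIMSEQ_inverse_real_of_nat by (intro tendsto_intros) (simp add: inverse_eq_divide)
  ultimately have "J v \<le> m + 0"
    by (rule LIMSEQ_le) (use X less_imp_le in blast)
  then have min: "J v \<le> J x" for x
    using m_le[of x] by simp
  have "\<phi> x = inner v x" for x
  proof -
    define a where "a = inner v x - \<phi> x"
    have "0 \<le> 2 * t * a + t\<^sup>2 * (norm x)\<^sup>2" for t
    proof -
      have "J (v + t *\<^sub>R x) = J v + 2 * t * a + t\<^sup>2 * (norm x)\<^sup>2"
        by (simp add: J_def a_def power2_norm_eq_inner inner_add_left inner_add_right
            \<phi>.add \<phi>.scaleR inner_commute algebra_simps power2_eq_square[of t])
      then show ?thesis
        using min[of "v + t *\<^sub>R x"] by simp
    qed
    \<comment> \<open>The value of \<open>t\<close> minimising a quadratic that dominates this one.\<close>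
    from this[of "- a / (1 + (norm x)\<^sup>2)"]
    have "0 \<le> 2 * (- a / (1 + (norm x)\<^sup>2)) * a + (a / (1 + (norm x)\<^sup>2))\<^sup>2 * (norm x)\<^sup>2"
      by (simp add: power_divide)
    also have "\<dots> \<le> 2 * (- a / (1 + (norm x)\<^sup>2)) * a + (a / (1 + (norm x)\<^sup>2))\<^sup>2 * (1 + (norm x)\<^sup>2)"
      by (intro add_left_mono mult_left_mono) auto
    also have "\<dots> = - (a\<^sup>2 / (1 + (norm x)\<^sup>2))"
      by (simp add: field_simps power2_eq_square add_nonneg_eq_0_iff)
    finally have "a\<^sup>2 / (1 + (norm x)\<^sup>2) \<le> 0"
      by simp
    then have "a = 0"
      by (simp add: divide_le_0_iff add_nonneg_eq_0_iff) (smt (verit) zero_le_power2)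
    then show ?thesis
      by (simp add: a_def)
  qed
  then show ?thesis
    by blast
qed

lemma clin_opsD: "T \<in> clin_ops \<Longrightarrow> blinfun_apply T (c *\<^sub>C x) = c *\<^sub>C T x"
  by (simp add: clin_ops_def)

text \<open>Riesz representation for the real inner product gives an adjoint with respect to it; complex
  linearity of \<open>T\<close> upgrades the identity to the Hermitian form.\<close>

lemma cadjoint_exists:
  fixes T :: "'a::chilbert_space \<Rightarrow>\<^sub>L 'a"
  assumes T: "T \<in> clin_ops"
  shows "\<exists>S :: 'a \<Rightarrow>\<^sub>L 'a. \<forall>x y. cinner (T x) y = cinner x (S y)"
proof -
  have "\<exists>v. \<forall>x. inner y (T x) = inner v x" for y
    by (intro Riesz_representation bounded_linear_compose[OF bounded_linear_inner_right]
        blinfun.bounded_linear_right)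
  then obtain S where "\<And>x y. inner y (T x) = inner (S y) x"
    by metis
  then have S: "inner (T x) y = inner x (S y)" for x y
    by (simp add: inner_commute)
  have S_eq: "cinner (T x) y = cinner x (S y)" for x y
  proof (rule complex_eqI)
    show "Re (cinner (T x) y) = Re (cinner x (S y))"
      using S[of x y] by (simp add: inner_eq_Re_cinner)
    \<comment> \<open>The imaginary part of \<open>cinner x y\<close> is the real part of \<open>cinner (\<i> x) y\<close>.\<close>
    show "Im (cinner (T x) y) = Im (cinner x (S y))"
      using S[of "\<i> *\<^sub>C x" y]
      by (simp add: inner_eq_Re_cinner clin_opsD[OF T] cinner_scaleC_left)
  qed
  have "bounded_linear S"
  proof (rule bounded_linear_intro)
    show "S (x + y) = S x + S y" for x y
      by (rule cinner_eqI) (simp add: S_eq[symmetric] cinner_add_right)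
    show "S (r *\<^sub>R x) = r *\<^sub>R S x" for r x
      by (rule cinner_eqI) (simp add: S_eq[symmetric] scaleR_scaleC cinner_scaleC_right)
    show "norm (S x) \<le> norm x * norm T" for x
    proof (cases "S x = 0")
      case False
      have "(norm (S x))\<^sup>2 = inner (T (S x)) x"
        by (simp add: S power2_norm_eq_inner)
      also have "\<dots> \<le> (norm T * norm (S x)) * norm x"
        by (intro order_trans[OF norm_cauchy_schwarz] mult_right_mono norm_blinfun) simp
      finally show ?thesis
        using False by (simp add: power2_eq_square mult_ac)
    qed simp
  qed
  then show ?thesis
    by (intro exI[of _ "Blinfun S"]) (simp add: bounded_linear_Blinfun_apply S_eq)
qed

lemma cinner_cadjoint:
  fixes T :: "'a::chilbert_space \<Rightarrow>\<^sub>L 'a"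
  assumes "T \<in> clin_ops"
  shows "cinner (T x) y = cinner x (cadjoint T y)"
proof -
  obtain S :: "'a \<Rightarrow>\<^sub>L 'a" where S: "\<forall>x y. cinner (T x) y = cinner x (S y)"
    using cadjoint_exists[OF assms] by blast
  have "cadjoint T = S"
    unfolding cadjoint_def
  proof (rule the_equality)
    fix S' :: "'a \<Rightarrow>\<^sub>L 'a" assume S': "\<forall>x y. cinner (T x) y = cinner x (S' y)"
    show "S' = S"
    proof (rule blinfun_eqI, rule cinner_eqI)
      show "cinner x (S' y) = cinner x (S y)" for x y
        using S[rule_format, of x y] S'[rule_format, of x y] by argo
    qed
  qed (rule S)
  then show ?thesis
    using S by simp
qed

section \<open>Invertibility and the spectrum\<close>

lemma clin_ops_compose: "S \<in> clin_ops \<Longrightarrow> T \<in> clin_ops \<Longrightarrow> S o\<^sub>L T \<in> clin_ops"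
  by (simp add: clin_ops_def)

lemma clin_ops_add: "S \<in> clin_ops \<Longrightarrow> T \<in> clin_ops \<Longrightarrow> S + T \<in> clin_ops"
  by (simp add: clin_ops_def blinfun.bilinear_simps scaleC_add_right)

lemma clin_ops_diff: "S \<in> clin_ops \<Longrightarrow> T \<in> clin_ops \<Longrightarrow> S - T \<in> clin_ops"
  by (simp add: clin_ops_def blinfun.bilinear_simps scaleC_diff_right)

lemma clin_ops_minus: "T \<in> clin_ops \<Longrightarrow> - T \<in> clin_ops"
  by (simp add: clin_ops_def blinfun.bilinear_simps scaleC_minus_right)

lemma clin_ops_scaleR: "T \<in> clin_ops \<Longrightarrow> r *\<^sub>R T \<in> clin_ops"
  by (simp add: clin_ops_def blinfun.bilinear_simps scaleR_scaleC_commute)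

definition cmul :: "complex \<Rightarrow> 'a::complex_inner \<Rightarrow>\<^sub>L 'a"
  where "cmul c = Blinfun (\<lambda>x. c *\<^sub>C x)"

lemma cmul_apply [simp]: "cmul c x = c *\<^sub>C x"
  by (simp add: cmul_def bounded_linear_Blinfun_apply bounded_linear_scaleC_right)

lemma norm_cmul_le: "norm (cmul c) \<le> cmod c"
  by (rule norm_blinfun_bound) (auto simp: norm_scaleC)

lemma clin_ops_cmul: "cmul c \<in> clin_ops"
  by (simp add: clin_ops_def scaleC_scaleC mult.commute)

definition op_inverse :: "('a::complex_inner \<Rightarrow>\<^sub>L 'a) \<Rightarrow> ('a \<Rightarrow>\<^sub>L 'a) \<Rightarrow> bool"
  where "op_inverse S T \<longleftrightarrow> S \<in> clin_ops \<and> (\<forall>x. S (T x) = x) \<and> (\<forall>x. T (S x) = x)"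

lemma not_in_Spec_iff: "z \<notin> Spec T \<longleftrightarrow> (\<exists>S. op_inverse S (T - cmul z))"
  by (auto simp: Spec_def op_inverse_def blinfun.bilinear_simps)

lemma op_inverse_id_minus:
  fixes P :: "'a::chilbert_space \<Rightarrow>\<^sub>L 'a"
  assumes P: "P \<in> clin_ops" "norm P < 1"
  shows "\<exists>S. op_inverse S (id_blinfun - P)"
proof -
  \<comment> \<open>The solution of \<open>x - P x = y\<close> is the fixed point of a contraction.\<close>
  have "\<exists>!x. y + P x = x" for y
    by (rule banach_fix_type[of "norm P"])
      (use P norm_blinfun[of P] in \<open>auto simp: dist_norm simp flip: blinfun.diff_right\<close>)
  then obtain S where S: "\<And>y. y + P (S y) = S y" and uniq: "\<And>x y. y + P x = x \<Longrightarrow> x = S y"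
    by metis
  have "bounded_linear S"
  proof (rule bounded_linear_intro)
    show "S (x + y) = S x + S y" for x y
      using arg_cong2[OF S[of x] S[of y], of "(+)"]
      by (intro uniq[symmetric]) (simp add: blinfun.add_right algebra_simps)
    show "S (r *\<^sub>R x) = r *\<^sub>R S x" for r x
      using arg_cong[OF S[of x], of "\<lambda>u. r *\<^sub>R u"]
      by (intro uniq[symmetric]) (simp add: blinfun.scaleR_right scaleR_add_right)
    show "norm (S x) \<le> norm x * (1 / (1 - norm P))" for x
    proof -
      have "norm (S x) \<le> norm x + norm P * norm (S x)"
        using norm_triangle_ineq[of x "P (S x)"] norm_blinfun[of P "S x"] S[of x] by simp
      then show ?thesis
        using P by (simp add: field_simps)
    qed
  qed
  moreover have "S (c *\<^sub>C x) = c *\<^sub>C S x" for c x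
    using arg_cong[OF S[of x], of "\<lambda>u. c *\<^sub>C u"]
    by (intro uniq[symmetric]) (simp add: clin_opsD[OF P(1)] scaleC_add_right)
  moreover have "S x - P (S x) = x" for x
    using S[of x] by (simp add: diff_eq_eq)
  moreover have "S (x - P x) = x" for x
    by (rule uniq[symmetric]) simp
  ultimately show ?thesis
    by (intro exI[of _ "Blinfun S"])
      (simp add: op_inverse_def clin_ops_def bounded_linear_Blinfun_apply blinfun.bilinear_simps)
qed

text \<open>\<open>T + B = T (1 + R B)\<close>, and \<open>1 + R B\<close> is invertible because \<open>\<parallel>R B\<parallel> < 1\<close>.\<close>

lemma op_inverse_perturb:
  fixes T :: "'a::chilbert_space \<Rightarrow>\<^sub>L 'a"
  assumes R: "op_inverse R T" and B: "B \<in> clin_ops" and small: "norm R * norm B < 1"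
  shows "\<exists>S. op_inverse S (T + B)"
proof -
  have R_clin: "R \<in> clin_ops"
    using R by (simp add: op_inverse_def)
  have "norm (- (R o\<^sub>L B)) < 1"
    using norm_blinfun_compose[of R B] small by simp
  then obtain U where U: "op_inverse U (id_blinfun - (- (R o\<^sub>L B)))"
    using op_inverse_id_minus clin_ops_minus clin_ops_compose R_clin B by blast
  have "T (U (R x)) + B (U (R x)) = x" for x
  proof -
    have "U (R x) + R (B (U (R x))) = R x"
      using U by (simp add: op_inverse_def blinfun.bilinear_simps)
    then have "T (U (R x) + R (B (U (R x)))) = T (R x)"
      by simp
    then show ?thesis
      using R by (simp add: op_inverse_def blinfun.bilinear_simps)
  qed
  moreover have "U (R (T x + B x)) = x" for x
    using U R by (simp add: op_inverse_def blinfun.bilinear_simps)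
  ultimately show ?thesis
    using clin_ops_compose[of U R] U R_clin
    by (intro exI[of _ "U o\<^sub>L R"]) (auto simp: op_inverse_def blinfun.bilinear_simps)
qed

lemma closed_Spec: "closed (Spec (T :: 'a::chilbert_space \<Rightarrow>\<^sub>L 'a))"
  unfolding closed_def open_dist
proof (intro ballI)
  fix z assume "z \<in> - Spec T"
  then obtain R where R: "op_inverse R (T - cmul z)"
    using not_in_Spec_iff by auto
  have "w \<in> - Spec T" if w: "dist w z < 1 / (norm R + 1)" for w
  proof -
    have "norm R * norm (cmul (z - w) :: 'a \<Rightarrow>\<^sub>L 'a) \<le> norm R * dist w z"
      by (intro mult_left_mono order_trans[OF norm_cmul_le]) (auto simp: dist_norm norm_minus_commute)
    also have "\<dots> \<le> (norm R + 1) * dist w z"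
      by (simp add: mult_right_mono)
    also have "\<dots> < 1"
      using w add_nonneg_pos[OF norm_ge_zero[of R] zero_less_one]
      by (simp add: pos_less_divide_eq mult.commute)
    finally obtain S where "op_inverse S (T - cmul z + cmul (z - w))"
      using op_inverse_perturb[OF R clin_ops_cmul] by blast
    moreover have "T - cmul z + cmul (z - w) = T - cmul w"
      by (rule blinfun_eqI)
        (simp add: blinfun.bilinear_simps scaleC_diff_left)
    ultimately show ?thesis
      using not_in_Spec_iff by auto
  qed
  then show "\<exists>e>0. \<forall>w. dist w z < e \<longrightarrow> w \<in> - Spec T"
    by (intro exI[of _ "1 / (norm R + 1)"]) (auto intro: add_nonneg_pos)
qed

section \<open>Resolvents of normal operators\<close>

text \<open>A consequence of normality that does not mention adjoints, and therefore passes easily to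
  inverses, scalar multiples and squares.\<close>

definition paranormal :: "('a::real_normed_vector \<Rightarrow>\<^sub>L 'a) \<Rightarrow> bool"
  where "paranormal T \<longleftrightarrow> (\<forall>x. (norm (T x))\<^sup>2 \<le> norm (T (T x)) * norm x)"

text \<open>A normal \<open>B\<close> satisfies \<open>\<parallel>B* y\<parallel> = \<parallel>B y\<parallel>\<close>, so that
  \<open>\<parallel>B x\<parallel>\<^sup>2 = \<langle>x, B* B x\<rangle> \<le> \<parallel>x\<parallel> \<parallel>B* B x\<parallel> = \<parallel>x\<parallel> \<parallel>B B x\<parallel>\<close>.\<close>

lemma paranormal_normal_shift:
  fixes T :: "'a::chilbert_space \<Rightarrow>\<^sub>L 'a"
  assumes T: "T \<in> clin_ops" and normal: "normal_op T"
  shows "paranormal (T - cmul z)"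
  unfolding paranormal_def
proof
  fix x
  define T' where "T' = cadjoint T"
  define B where "B = T - cmul z"
  define B' where "B' = T' - cmul (cnj z)"
  note adj = cinner_cadjoint[OF T, folded T'_def]
  have "T' (c *\<^sub>C y) = c *\<^sub>C T' y" for c y
    by (rule cinner_eqI) (simp add: adj[symmetric] cinner_scaleC_right)
  moreover have "T (T' y) = T' (T y)" for y
    using arg_cong[OF normal[unfolded normal_op_def], of "\<lambda>A. A y"] by (simp add: T'_def)
  ultimately have comm: "B (B' y) = B' (B y)" for y
    by (simp add: B_def B'_def blinfun.bilinear_simps scaleC_diff_right clin_opsD[OF T]
        scaleC_scaleC mult.commute algebra_simps)
  have adjB: "cinner (B u) v = cinner u (B' v)" for u v
    by (simp add: B_def B'_def blinfun.bilinear_simps adj cinner_diff_left cinner_diff_right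
        cinner_scaleC_left cinner_scaleC_right)
  have adjB': "cinner (B' u) v = cinner u (B v)" for u v
    by (metis adjB cinner_commute)
  have "cinner (B' y) (B' y) = cinner (B y) (B y)" for y
    by (simp add: adjB adjB' comm)
  then have "(norm (B' y))\<^sup>2 = (norm (B y))\<^sup>2" for y
    by (metis cinner_self of_real_eq_iff)
  then have norm_B': "norm (B' y) = norm (B y)" for y
    by simp
  have "complex_of_real ((norm (B x))\<^sup>2) = cinner x (B' (B x))"
    by (metis cinner_self adjB)
  then have "(norm (B x))\<^sup>2 = cmod (cinner x (B' (B x)))"
    by (metis norm_of_real abs_power2)
  also have "\<dots> \<le> norm x * norm (B' (B x))"
    by (rule norm_cinner_le)
  finally show "(norm ((T - cmul z) x))\<^sup>2 \<le> norm ((T - cmul z) ((T - cmul z) x)) * norm x"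
    by (simp add: norm_B' mult.commute flip: B_def)
qed

text \<open>Substitute \<open>R R x\<close> in the inequality for \<open>B\<close>.\<close>

lemma paranormal_inverse:
  assumes "op_inverse R B" "paranormal B"
  shows "paranormal R"
  unfolding paranormal_def
proof
  fix x
  have "(norm (B (R (R x))))\<^sup>2 \<le> norm (B (B (R (R x)))) * norm (R (R x))"
    using assms(2) by (simp add: paranormal_def)
  then show "(norm (R x))\<^sup>2 \<le> norm (R (R x)) * norm x"
    using assms(1) by (simp add: op_inverse_def mult.commute)
qed

lemma paranormal_scaleR: "paranormal T \<Longrightarrow> paranormal (r *\<^sub>R T)"
  unfolding paranormal_def
proof
  fix x assume "\<forall>x. (norm (T x))\<^sup>2 \<le> norm (T (T x)) * norm x"
  then have "r\<^sup>2 * (norm (T x))\<^sup>2 \<le> r\<^sup>2 * (norm (T (T x)) * norm x)"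
    by (intro mult_left_mono) auto
  then show "(norm ((r *\<^sub>R T) x))\<^sup>2 \<le> norm ((r *\<^sub>R T) ((r *\<^sub>R T) x)) * norm x"
    by (simp add: blinfun.bilinear_simps power_mult_distrib mult_ac flip: power2_eq_square)
qed

text \<open>Put \<open>a\<^sub>n = \<parallel>T\<^sup>n x\<parallel>\<close>. Then \<open>a\<^sub>1\<^sup>2 \<le> a\<^sub>0 a\<^sub>2\<close>, \<open>a\<^sub>2\<^sup>2 \<le> a\<^sub>1 a\<^sub>3\<close> and \<open>a\<^sub>3\<^sup>2 \<le> a\<^sub>2 a\<^sub>4\<close>
  give \<open>a\<^sub>2\<^sup>2 \<le> a\<^sub>0 a\<^sub>4\<close>.\<close>

lemma paranormal_square:
  assumes T: "paranormal T"
  shows "paranormal (T o\<^sub>L T)"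
  unfolding paranormal_def
proof
  fix x
  define a0 a1 a2 a3 a4 where a: "a0 = norm x" "a1 = norm (T x)" "a2 = norm (T (T x))"
    "a3 = norm (T (T (T x)))" "a4 = norm (T (T (T (T x))))"
  have ineq: "a1\<^sup>2 \<le> a2 * a0" "a2\<^sup>2 \<le> a3 * a1" "a3\<^sup>2 \<le> a4 * a2"
    using T by (simp_all add: paranormal_def a)
  have nonneg: "0 \<le> a0" "0 \<le> a1" "0 \<le> a2" "0 \<le> a3" "0 \<le> a4"
    by (simp_all add: a)
  have "a2\<^sup>2 \<le> a4 * a0"
  proof (cases "a2 = 0")
    case False
    have "a2\<^sup>2 * a2\<^sup>2 \<le> (a3 * a1) * (a3 * a1)"
      using ineq(2) by (intro mult_mono) (use nonneg in auto)
    also have "\<dots> = a3\<^sup>2 * a1\<^sup>2"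
      by (simp add: power2_eq_square)
    also have "\<dots> \<le> (a4 * a2) * (a2 * a0)"
      using ineq by (intro mult_mono) (use nonneg in auto)
    also have "\<dots> = a2\<^sup>2 * (a4 * a0)"
      by (simp add: power2_eq_square)
    finally show ?thesis
      by (rule mult_left_le_imp_le) (use False in simp)
  qed (use nonneg in auto)
  then show "(norm ((T o\<^sub>L T) x))\<^sup>2 \<le> norm ((T o\<^sub>L T) ((T o\<^sub>L T) x)) * norm x"
    by (simp add: a)
qed

lemma norm_paranormal_square:
  assumes T: "paranormal T"
  shows "norm (T o\<^sub>L T) = (norm T)\<^sup>2"
proof (rule antisym)
  show "norm (T o\<^sub>L T) \<le> (norm T)\<^sup>2"
    by (metis norm_blinfun_compose power2_eq_square)
  have "norm T \<le> sqrt (norm (T o\<^sub>L T))"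
  proof (rule norm_blinfun_bound)
    fix x
    have "(norm (T x))\<^sup>2 \<le> norm ((T o\<^sub>L T) x) * norm x"
      using T by (simp add: paranormal_def)
    also have "\<dots> \<le> (norm (T o\<^sub>L T) * norm x) * norm x"
      by (intro mult_right_mono norm_blinfun) simp
    also have "\<dots> = (sqrt (norm (T o\<^sub>L T)) * norm x)\<^sup>2"
      by (simp add: power_mult_distrib power2_eq_square)
    finally show "norm (T x) \<le> sqrt (norm (T o\<^sub>L T)) * norm x"
      by (rule power2_le_imp_le) simp
  qed simp
  then show "(norm T)\<^sup>2 \<le> norm (T o\<^sub>L T)"
    by (metis norm_ge_zero power_mono real_sqrt_pow2)
qed

text \<open>The powers \<open>P ^ (2 ^ k)\<close>, by repeated squaring: both the norm identity for paranormal operators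
  and the averaging identity below advance by one squaring at a time.\<close>

primrec dyadic_power :: "('a::real_normed_vector \<Rightarrow>\<^sub>L 'a) \<Rightarrow> nat \<Rightarrow> 'a \<Rightarrow>\<^sub>L 'a"
  where
    "dyadic_power P 0 = P"
  | "dyadic_power P (Suc k) = dyadic_power P k o\<^sub>L dyadic_power P k"

lemma clin_ops_dyadic_power: "P \<in> clin_ops \<Longrightarrow> dyadic_power P k \<in> clin_ops"
  by (induction k) (auto intro: clin_ops_compose)

lemma norm_dyadic_power_le:
  assumes "norm P \<le> 1"
  shows "norm (dyadic_power P k) \<le> 1"
proof (induction k)
  case (Suc k)
  have "norm (dyadic_power P (Suc k)) \<le> norm (dyadic_power P k) * norm (dyadic_power P k)"
    by (simp add: norm_blinfun_compose)
  also have "\<dots> \<le> 1"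
    using Suc by (intro mult_le_one) auto
  finally show ?case .
qed (use assms in simp)

lemma norm_dyadic_power_paranormal:
  assumes "paranormal P"
  shows "norm (dyadic_power P k) = norm P ^ (2 ^ k)"
proof -
  have "paranormal (dyadic_power P k) \<and> norm (dyadic_power P k) = norm P ^ (2 ^ k)"
    using assms
    by (induction k) (auto simp: paranormal_square norm_paranormal_square mult.commute
        simp flip: power_mult)
  then show ?thesis ..
qed

text \<open>Partial fractions: since \<open>1 - r\<^sup>2 Q\<^sup>2 = (1 - r Q) (1 + r Q)\<close>, its product with
  \<open>(1 - r Q)\<inverse> + (1 + r Q)\<inverse>\<close> is \<open>(1 + r Q) + (1 - r Q) = 2\<close>.\<close>

lemma op_inverse_average:
  fixes Q :: "'a::complex_inner \<Rightarrow>\<^sub>L 'a"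
  assumes Q: "Q \<in> clin_ops"
    and S1: "op_inverse S1 (id_blinfun - (cmul r o\<^sub>L Q))"
    and S2: "op_inverse S2 (id_blinfun - (cmul (- r) o\<^sub>L Q))"
  shows "op_inverse ((1/2) *\<^sub>R (S1 + S2)) (id_blinfun - (cmul (r\<^sup>2) o\<^sub>L (Q o\<^sub>L Q)))"
proof -
  define N where "N = cmul r o\<^sub>L Q"
  have NN: "cmul (r\<^sup>2) o\<^sub>L (Q o\<^sub>L Q) = N o\<^sub>L N"
    by (rule blinfun_eqI) (simp add: N_def clin_opsD[OF Q] scaleC_scaleC power2_eq_square)
  have minus: "cmul (- r) o\<^sub>L Q = - N"
    by (rule blinfun_eqI) (simp add: N_def blinfun.bilinear_simps scaleC_minus_left)
  have clin: "S1 \<in> clin_ops" "S2 \<in> clin_ops"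
    and S1': "S1 (x - N x) = x" "S1 x - N (S1 x) = x"
    and S2': "S2 (x + N x) = x" "S2 x + N (S2 x) = x" for x
    using S1 S2 by (auto simp: op_inverse_def N_def[symmetric] minus blinfun.bilinear_simps)
  have left: "S1 (x - N (N x)) + S2 (x - N (N x)) = 2 *\<^sub>R x" for x
  proof -
    have "S1 (x - N (N x)) = x + N x"
      using S1'(1)[of "x + N x"] by (simp add: blinfun.bilinear_simps)
    moreover have "S2 (x - N (N x)) = x - N x"
      using S2'(1)[of "x - N x"] by (simp add: blinfun.bilinear_simps)
    ultimately show ?thesis
      by (simp add: scaleR_2)
  qed
  have right: "(S1 x + S2 x) - N (N (S1 x + S2 x)) = 2 *\<^sub>R x" for x
  proof -
    have "y - N (N y) = (y - N y) + N (y - N y)" for y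
      by (simp add: blinfun.diff_right)
    from this[of "S1 x"] have e1: "S1 x - N (N (S1 x)) = x + N x"
      by (simp only: S1')
    have "y - N (N y) = (y + N y) - N (y + N y)" for y
      by (simp add: blinfun.add_right)
    from this[of "S2 x"] have e2: "S2 x - N (N (S2 x)) = x - N x"
      by (simp only: S2')
    have "(S1 x + S2 x) - N (N (S1 x + S2 x)) = (S1 x - N (N (S1 x))) + (S2 x - N (N (S2 x)))"
      by (simp add: blinfun.add_right)
    also have "\<dots> = 2 *\<^sub>R x"
      unfolding e1 e2 by (simp add: scaleR_2)
    finally show ?thesis .
  qed
  define S where "S = (1/2) *\<^sub>R (S1 + S2)"
  have S_apply: "S x = (1/2) *\<^sub>R (S1 x + S2 x)" for x
    by (simp add: S_def blinfun.bilinear_simps)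
  have "S \<in> clin_ops"
    unfolding S_def by (intro clin_ops_scaleR clin_ops_add clin)
  moreover have "S (x - N (N x)) = x" for x
    unfolding S_apply left by simp
  moreover have "S x - N (N (S x)) = x" for x
    unfolding S_apply blinfun.scaleR_right scaleR_diff_right[symmetric] right by simp
  ultimately show ?thesis
    unfolding NN S_def[symmetric] by (simp add: op_inverse_def blinfun.diff_left)
qed

text \<open>\<open>\<Psi> w - \<Psi> v = (w - v) \<Psi> w P \<Psi> v\<close>. Applied with \<open>w\<close> close to \<open>v\<close>, this first bounds \<open>\<parallel>\<Psi> w\<parallel>\<close>
  by \<open>2 (\<parallel>\<Psi> v\<parallel> + 1)\<close> and then shows continuity.\<close>

lemma resolvent_uniformly_continuous:
  fixes P :: "'a::complex_inner \<Rightarrow>\<^sub>L 'a"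
  assumes "compact K" and "norm P \<le> 1"
    and \<Psi>: "\<And>w. w \<in> K \<Longrightarrow> op_inverse (\<Psi> w) (id_blinfun - (cmul w o\<^sub>L P))"
  shows "uniformly_continuous_on K \<Psi>"
proof (rule compact_uniformly_continuous)
  have diff: "norm (\<Psi> w - \<Psi> v) \<le> norm (w - v) * norm (\<Psi> w) * norm (\<Psi> v)"
    if "w \<in> K" "v \<in> K" for w v
  proof -
    have "\<Psi> w - \<Psi> v = \<Psi> w o\<^sub>L cmul (w - v) o\<^sub>L P o\<^sub>L \<Psi> v"
    proof (rule blinfun_eqI)
      fix x
      define y where "y = \<Psi> v x"
      have "x = y - v *\<^sub>C P y"
        using \<Psi>[OF \<open>v \<in> K\<close>] by (simp add: op_inverse_def y_def blinfun.bilinear_simps)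
      also have "\<dots> = (y - w *\<^sub>C P y) + (w - v) *\<^sub>C P y"
        by (simp add: scaleC_diff_left)
      finally have "\<Psi> w x = \<Psi> w (y - w *\<^sub>C P y) + \<Psi> w ((w - v) *\<^sub>C P y)"
        by (simp add: blinfun.add_right)
      also have "\<Psi> w (y - w *\<^sub>C P y) = y"
        using \<Psi>[OF \<open>w \<in> K\<close>] by (simp add: op_inverse_def blinfun.bilinear_simps)
      finally show "(\<Psi> w - \<Psi> v) x = (\<Psi> w o\<^sub>L cmul (w - v) o\<^sub>L P o\<^sub>L \<Psi> v) x"
        by (simp add: blinfun.bilinear_simps y_def)
    qed
    also have "norm \<dots> \<le> norm (\<Psi> w) * norm (w - v) * 1 * norm (\<Psi> v)"
      using assms(2)
      by (intro order_trans[OF norm_blinfun_compose] mult_mono norm_cmul_le) auto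
    finally show ?thesis
      by (simp add: mult_ac)
  qed
  show "continuous_on K \<Psi>"
    unfolding continuous_on_iff
  proof (intro ballI allI impI)
    fix v \<epsilon> assume v: "v \<in> K" and \<epsilon>: "0 < (\<epsilon>::real)"
    define C where "C = norm (\<Psi> v) + 1"
    have C: "1 \<le> C" "norm (\<Psi> v) \<le> C"
      by (simp_all add: C_def)
    define \<delta> where "\<delta> = min (1 / (2 * C)) (\<epsilon> / (2 * C\<^sup>2))"
    have "0 < \<delta>"
      using C \<epsilon> by (simp add: \<delta>_def)
    moreover have "dist (\<Psi> w) (\<Psi> v) < \<epsilon>" if w: "w \<in> K" and d: "dist w v < \<delta>" for w
    proof -
      have d1: "norm (w - v) * C \<le> 1 / 2" and d2: "norm (w - v) * (2 * C\<^sup>2) < \<epsilon>"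
        using d C by (auto simp: \<delta>_def dist_norm field_simps)
      have le: "norm (\<Psi> w - \<Psi> v) \<le> norm (w - v) * C * norm (\<Psi> w)"
        using diff[OF w v] C
        by (smt (verit, best) mult.assoc mult.commute mult_left_mono norm_ge_zero mult_nonneg_nonneg)
      also have "\<dots> \<le> 1 / 2 * norm (\<Psi> w)"
        by (intro mult_right_mono d1) simp
      finally have "norm (\<Psi> w) \<le> 2 * C"
        using norm_triangle_ineq2[of "\<Psi> w" "\<Psi> v"] C by simp
      then have "norm (w - v) * C * norm (\<Psi> w) \<le> norm (w - v) * C * (2 * C)"
        using C by (intro mult_left_mono) auto
      then show ?thesis
        using le d2 by (simp add: dist_norm power2_eq_square mult_ac)
    qed
    ultimately show "\<exists>d>0. \<forall>w\<in>K. dist w v < d \<longrightarrow> dist (\<Psi> w) (\<Psi> v) < \<epsilon>"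
      by blast
  qed
qed fact

text \<open>The average of \<open>(1 - \<omega> s P)\<inverse>\<close> over the \<open>n\<close>-th roots of unity \<open>\<omega>\<close> is \<open>(1 - s\<^sup>n P\<^sup>n)\<inverse>\<close>; for
  \<open>n = 2\<^sup>k\<close> it arises by repeated averaging over \<open>\<plusminus>1\<close>. Averages do not increase distances, so
  uniform continuity of the resolvent yields one \<open>t < 1\<close> for which \<open>(1 - P\<^sup>n)\<inverse>\<close> is close to
  \<open>(1 - t\<^sup>n P\<^sup>n)\<inverse>\<close> for all these \<open>n\<close> at once. The latter tends to \<open>1\<close> as \<open>n\<close> grows, and an
  operator \<open>P\<^sup>n\<close> for which \<open>(1 - P\<^sup>n)\<inverse>\<close> is close to \<open>1\<close> is small.\<close>

lemma dyadic_power_contracts: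
  fixes P :: "'a::complex_inner \<Rightarrow>\<^sub>L 'a"
  assumes P: "P \<in> clin_ops" "norm P \<le> 1"
    and inv: "\<And>w. cmod w \<le> 1 \<Longrightarrow> \<exists>S. op_inverse S (id_blinfun - (cmul w o\<^sub>L P))"
  shows "\<exists>k. norm (dyadic_power P k) < 1"
proof -
  obtain \<Psi> where \<Psi>: "\<And>w. cmod w \<le> 1 \<Longrightarrow> op_inverse (\<Psi> w) (id_blinfun - (cmul w o\<^sub>L P))"
    using inv by metis
  have "uniformly_continuous_on (cball 0 1) \<Psi>"
    by (rule resolvent_uniformly_continuous[OF compact_cball P(2)]) (simp add: \<Psi>)
  then obtain \<delta> where \<delta>: "0 < \<delta>" and
    unif: "\<And>v w. cmod v \<le> 1 \<Longrightarrow> cmod w \<le> 1 \<Longrightarrow> dist v w < \<delta> \<Longrightarrow> dist (\<Psi> v) (\<Psi> w) < 1 / 8"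
    unfolding uniformly_continuous_on_def
    by (smt (verit, ccfv_threshold) mem_cball_0 zero_less_divide_1_iff)
  define t where "t = 1 - min \<delta> 1 / 2"
  have t: "0 < t" "t < 1" "1 - t < \<delta>"
    using \<delta> by (auto simp: t_def min_def)
  have approx: "\<exists>S S'. op_inverse S (id_blinfun - (cmul s o\<^sub>L dyadic_power P k)) \<and>
      op_inverse S' (id_blinfun - (cmul (of_real (t ^ 2 ^ k) * s) o\<^sub>L dyadic_power P k)) \<and>
      norm (S - S') \<le> 1 / 8" if "cmod s \<le> 1" for s k
    using that
  proof (induction k arbitrary: s)
    case 0
    have ts: "cmod (of_real t * s) \<le> 1"
      using 0 t by (auto simp: norm_mult intro: mult_le_one)
    have "s - of_real t * s = of_real (1 - t) * s"
      by (simp add: algebra_simps)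
    then have "dist s (of_real t * s) = (1 - t) * cmod s"
      using t by (simp add: dist_norm norm_mult del: of_real_diff)
    also have "\<dots> < \<delta>"
      using t 0 by (smt (verit) mult_left_le)
    finally have "norm (\<Psi> s - \<Psi> (of_real t * s)) \<le> 1 / 8"
      using unif[OF 0 ts] by (simp add: dist_norm)
    then show ?case
      using \<Psi>[OF 0] \<Psi>[OF ts] by auto
  next
    case (Suc k)
    define Q where "Q = dyadic_power P k"
    define \<tau> where "\<tau> = complex_of_real (t ^ 2 ^ k)"
    \<comment> \<open>The point \<open>s\<close> for the exponent \<open>2 n\<close> is the average over its two square roots for \<open>n\<close>.\<close>
    define r where "r = csqrt s"
    have r: "cmod r \<le> 1" "cmod (- r) \<le> 1" and r2: "r\<^sup>2 = s"
      using Suc.prems by (simp_all add: r_def norm_csqrt)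
    have \<tau>2: "complex_of_real (t ^ 2 ^ Suc k) * s = (\<tau> * r)\<^sup>2"
      by (simp add: \<tau>_def r2 power_mult_distrib mult.commute flip: power_mult)
    have Q: "Q \<in> clin_ops"
      unfolding Q_def by (rule clin_ops_dyadic_power[OF P(1)])
    obtain S1 S1' where
      S1: "op_inverse S1 (id_blinfun - (cmul r o\<^sub>L Q))"
        "op_inverse S1' (id_blinfun - (cmul (\<tau> * r) o\<^sub>L Q))" "norm (S1 - S1') \<le> 1 / 8"
      using Suc.IH[OF r(1)] unfolding Q_def \<tau>_def by blast
    obtain S2 S2' where
      S2: "op_inverse S2 (id_blinfun - (cmul (- r) o\<^sub>L Q))"
        "op_inverse S2' (id_blinfun - (cmul (- (\<tau> * r)) o\<^sub>L Q))" "norm (S2 - S2') \<le> 1 / 8"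
      using Suc.IH[OF r(2)] unfolding Q_def \<tau>_def mult_minus_right by blast
    define S where "S = (1/2) *\<^sub>R (S1 + S2)"
    define S' where "S' = (1/2) *\<^sub>R (S1' + S2')"
    have "op_inverse S (id_blinfun - (cmul s o\<^sub>L dyadic_power P (Suc k)))"
      using op_inverse_average[OF Q S1(1) S2(1)] by (simp add: S_def r2 Q_def)
    moreover have "op_inverse S'
        (id_blinfun - (cmul (of_real (t ^ 2 ^ Suc k) * s) o\<^sub>L dyadic_power P (Suc k)))"
      using op_inverse_average[OF Q S1(2) S2(2)] unfolding \<tau>2 by (simp add: S'_def Q_def)
    moreover have "norm (S - S') \<le> 1 / 8"
    proof -
      have "S - S' = (1/2) *\<^sub>R ((S1 - S1') + (S2 - S2'))"
        by (simp add: S_def S'_def algebra_simps)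
      then have "norm (S - S') = 1/2 * norm ((S1 - S1') + (S2 - S2'))"
        by simp
      then show ?thesis
        using norm_triangle_ineq[of "S1 - S1'" "S2 - S2'"] S1(3) S2(3) by linarith
    qed
    ultimately show ?case
      by blast
  qed
  \<comment> \<open>If \<open>\<tau> = t\<^sup>n \<le> 1 / 9\<close>, then \<open>(1 - \<tau> P\<^sup>n)\<inverse>\<close> differs from \<open>1\<close> by at most
    \<open>\<tau> / (1 - \<tau>) \<le> 1 / 8\<close>, so \<open>(1 - P\<^sup>n)\<inverse>\<close> differs from \<open>1\<close> by at most \<open>1 / 4\<close>.\<close>
  obtain k where k: "t ^ k < 1 / 9"
    using real_arch_pow_inv[of "1 / 9" t] t by auto
  define \<tau> where "\<tau> = t ^ 2 ^ k"
  define Q where "Q = dyadic_power P k"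
  have "\<tau> \<le> t ^ k"
    unfolding \<tau>_def using t by (intro power_decreasing) (auto intro: less_imp_le)
  then have "\<tau> \<le> 1 / 9"
    using k by linarith
  moreover have "0 \<le> \<tau>"
    using t by (simp add: \<tau>_def)
  ultimately have \<tau>: "0 \<le> \<tau>" "\<tau> \<le> 1 / 9"
    by simp_all
  obtain S S' where S: "op_inverse S (id_blinfun - (cmul 1 o\<^sub>L Q))"
    and S': "op_inverse S' (id_blinfun - (cmul (of_real \<tau>) o\<^sub>L Q))" and SS': "norm (S - S') \<le> 1 / 8"
    using approx[of 1 k] by (auto simp: Q_def \<tau>_def)
  have S_id: "norm (S x - x) \<le> norm x / 4" for x
  proof -
    define y where "y = S' x"
    have x: "x = y - \<tau> *\<^sub>R Q y"
      using S' by (simp add: op_inverse_def y_def blinfun.bilinear_simps scaleR_scaleC)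
    have "y - x = \<tau> *\<^sub>R Q y"
      by (subst x) simp
    then have "norm (y - x) \<le> \<tau> * norm (Q y)"
      using \<tau> by simp
    also have "\<dots> \<le> 1 / 9 * (1 * norm y)"
      using \<tau> norm_dyadic_power_le[OF P(2), of k]
      by (intro mult_mono order_trans[OF norm_blinfun[of Q y]] mult_right_mono) (auto simp: Q_def)
    finally have "norm (y - x) \<le> norm x / 8"
      using norm_triangle_ineq2[of y x] by simp
    moreover have "norm (S x - y) \<le> 1 / 8 * norm x"
      using order_trans[OF norm_blinfun[of "S - S'" x] mult_right_mono[OF SS' norm_ge_zero]]
      by (simp add: blinfun.diff_left y_def)
    ultimately show ?thesis
      using norm_triangle_ineq[of "S x - y" "y - x"] by simp
  qed
  have "norm Q \<le> 1 / 3"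
  proof (rule norm_blinfun_bound)
    fix x
    have "S (x - Q x) = x"
      using S by (simp add: op_inverse_def blinfun.bilinear_simps scaleC_one)
    then have "norm (Q x) \<le> norm (x - Q x) / 4"
      using S_id[of "x - Q x"] by simp
    then show "norm (Q x) \<le> 1 / 3 * norm x"
      using norm_triangle_ineq4[of x "Q x"] by simp
  qed simp
  then show ?thesis
    unfolding Q_def by (intro exI[of _ k]) simp
qed

text \<open>If the bound failed, \<open>P = R / \<parallel>R\<parallel>\<close> would be a paranormal operator of norm one whose
  dyadic powers have norm one, although \<open>1 - w P\<close> is invertible for \<open>\<bar>w\<bar> \<le> 1\<close>:
  up to the factor \<open>T - z\<close> it is \<open>T - (z + w / \<parallel>R\<parallel>)\<close>, with \<open>z + w / \<parallel>R\<parallel>\<close> in the disc.\<close>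

lemma norm_resolvent_le:
  fixes T :: "'a::complex_inner \<Rightarrow>\<^sub>L 'a"
  assumes T: "T \<in> clin_ops" and para: "paranormal (T - cmul z)"
    and R: "op_inverse R (T - cmul z)"
    and d: "0 < d" and disc: "ball z d \<inter> Spec T = {}"
  shows "norm R \<le> 1 / d"
proof (rule ccontr)
  assume "\<not> norm R \<le> 1 / d"
  then have large: "1 / d < norm R"
    by simp
  define \<rho> where "\<rho> = norm R"
  have "0 < 1 / d"
    using d by simp
  then have "0 < norm R"
    using large by (rule less_trans)
  then have \<rho>: "0 < \<rho>" "1 / \<rho> < d"
    using large d by (simp_all add: \<rho>_def field_simps)
  define P where "P = (1 / \<rho>) *\<^sub>R R"
  have R_clin: "R \<in> clin_ops"
    using R by (simp add: op_inverse_def)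
  then have P: "P \<in> clin_ops"
    unfolding P_def by (rule clin_ops_scaleR)
  have norm_P: "norm P = 1"
    using \<rho> by (simp add: P_def \<rho>_def[symmetric])
  have "paranormal P"
    unfolding P_def by (intro paranormal_scaleR paranormal_inverse[OF R para])
  have "\<exists>S. op_inverse S (id_blinfun - (cmul w o\<^sub>L P))" if w: "cmod w \<le> 1" for w
  proof -
    define u where "u = w / of_real \<rho>"
    define B where "B = T - cmul z"
    have "cmod u \<le> 1 / \<rho>"
      using w \<rho> by (simp add: u_def norm_divide divide_right_mono)
    then have "z + u \<in> ball z d"
      using \<rho> by (simp add: dist_norm)
    then obtain S where S: "op_inverse S (T - cmul (z + u))"
      using disc not_in_Spec_iff[of "z + u" T] by blast
    have B: "B x - u *\<^sub>C x = (T - cmul (z + u)) x" for x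
      by (simp add: B_def blinfun.bilinear_simps scaleC_add_left)
    have S_left: "S (B x) - u *\<^sub>C S x = x" for x
    proof -
      have "S (B x) - u *\<^sub>C S x = S (B x - u *\<^sub>C x)"
        using S by (simp add: blinfun.diff_right clin_opsD op_inverse_def)
      then show ?thesis
        using S by (simp add: B op_inverse_def)
    qed
    have S_right: "B (S x) - u *\<^sub>C S x = x" for x
      using S by (simp add: B op_inverse_def)
    have RB: "R (B x) = x" "B (R x) = x" for x
      using R by (simp_all add: op_inverse_def B_def)
    have wP: "cmul w o\<^sub>L P = cmul u o\<^sub>L R"
      by (rule blinfun_eqI)
        (simp add: P_def u_def blinfun.bilinear_simps scaleR_scaleC scaleC_scaleC)
    have SB: "S (B x) = B (S x)" for x
      by (metis S_left S_right diff_eq_eq)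
    have "op_inverse (S o\<^sub>L B) (id_blinfun - (cmul u o\<^sub>L R))"
    proof -
      have "S o\<^sub>L B \<in> clin_ops"
        using S T unfolding B_def
        by (intro clin_ops_compose clin_ops_diff clin_ops_cmul) (auto simp: op_inverse_def)
      moreover have "S (B (x - u *\<^sub>C R x)) = x" for x
      proof -
        have "B (x - u *\<^sub>C R x) = B x - u *\<^sub>C x"
          using clin_opsD[OF clin_ops_diff[OF T clin_ops_cmul[of z]]]
          by (simp add: blinfun.diff_right RB flip: B_def)
        then show ?thesis
          using S by (simp add: B op_inverse_def)
      qed
      moreover have "S (B x) - u *\<^sub>C R (S (B x)) = x" for x
      proof -
        have "R (S (B x)) = S x"
          by (simp add: SB RB)
        then show ?thesis
          by (simp add: S_left)
      qed
      ultimately show ?thesis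
        by (simp add: op_inverse_def blinfun.diff_left)
    qed
    then show ?thesis
      unfolding wP by blast
  qed
  then obtain k where "norm (dyadic_power P k) < 1"
    using dyadic_power_contracts[OF P] norm_P by auto
  then show False
    using norm_dyadic_power_paranormal[OF \<open>paranormal P\<close>, of k] norm_P by simp
qed

section \<open>Orthonormal bases of finite families\<close>

text \<open>The Gram--Schmidt process. An orthonormal basis of the span of \<open>F\<close> satisfies Bessel's
  inequality, with equality on \<open>F\<close>.\<close>

lemma finite_Parseval:
  fixes F :: "'a::complex_inner set"
  assumes "finite F"
  obtains B where "finite B" "\<And>v. (\<Sum>b\<in>B. (cmod (cinner b v))\<^sup>2) \<le> (norm v)\<^sup>2"
    "\<And>v. v \<in> F \<Longrightarrow> (\<Sum>b\<in>B. (cmod (cinner b v))\<^sup>2) = (norm v)\<^sup>2"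
proof -
  define proj where "proj B v = (\<Sum>b\<in>B. cinner b v *\<^sub>C b)" for B and v :: 'a
  define ortho where "ortho B \<longleftrightarrow> finite B \<and> (\<forall>a\<in>B. \<forall>b\<in>B. cinner a b = (if a = b then 1 else 0))"
    for B :: "'a set"
  have perp: "cinner b (v - proj B v) = 0" if "ortho B" "b \<in> B" for B b v
  proof -
    have "cinner b (proj B v) = (\<Sum>a\<in>B. if a = b then cinner b v else 0)"
      unfolding proj_def cinner_sum_right
      by (rule sum.cong) (use that in \<open>auto simp: ortho_def cinner_scaleC_right\<close>)
    then show ?thesis
      using that by (simp add: cinner_diff_right ortho_def)
  qed
  have "\<exists>B. ortho B \<and> (\<forall>v\<in>F. proj B v = v)"
    using assms
  proof (induction F rule: finite_induct)
    case empty
    show ?case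
      by (rule exI[of _ "{}"]) (simp add: ortho_def)
  next
    case (insert u F)
    then obtain B where B: "ortho B" and F: "\<And>v. v \<in> F \<Longrightarrow> proj B v = v"
      by blast
    show ?case
    proof (cases "proj B u = u")
      case True
      then show ?thesis
        using B F by auto
    next
      case False
      define n where "n = norm (u - proj B u)"
      have n: "0 < n"
        using False by (simp add: n_def)
      define w where "w = (1 / n) *\<^sub>R (u - proj B u)"
      have w_B: "cinner b w = 0" if "b \<in> B" for b
        using perp[OF B that] by (simp add: w_def scaleR_scaleC cinner_scaleC_right)
      then have B_w: "cinner w b = 0" if "b \<in> B" for b
        using that cinner_commute[of w b] by simp
      have "norm w = 1"
        using n by (simp add: w_def n_def)
      then have w_w: "cinner w w = 1"
        by (simp add: cinner_self)
      then have "w \<notin> B"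
        using w_B by fastforce
      have w_proj: "cinner w (proj B v) = 0" for v
        by (simp add: proj_def cinner_sum_right cinner_scaleC_right B_w)
      have proj_w: "proj (insert w B) v = cinner w v *\<^sub>C w + proj B v" for v
        using B \<open>w \<notin> B\<close> by (simp add: proj_def ortho_def)
      have "ortho (insert w B)"
        using B w_B B_w w_w \<open>w \<notin> B\<close> by (auto simp: ortho_def)
      moreover have "proj (insert w B) v = v" if "v \<in> F" for v
        using w_proj[of v] F[OF that] by (simp add: proj_w)
      moreover have "proj (insert w B) u = u"
      proof -
        have u: "u = n *\<^sub>R w + proj B u"
          using n by (simp add: w_def)
        have "cinner w u = cinner w (n *\<^sub>R w + proj B u)"
          using u by simp
        also have "\<dots> = n"
          by (simp add: cinner_add_right scaleR_scaleC cinner_scaleC_right w_w w_proj)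
        finally show ?thesis
          using u by (simp add: proj_w scaleR_scaleC)
      qed
      ultimately show ?thesis
        by blast
    qed
  qed
  then obtain B where B: "ortho B" and F: "\<And>v. v \<in> F \<Longrightarrow> proj B v = v"
    by blast
  have pyth: "(norm v)\<^sup>2 = (\<Sum>b\<in>B. (cmod (cinner b v))\<^sup>2) + (norm (v - proj B v))\<^sup>2" for v
  proof -
    have "cinner (proj B v) (v - proj B v) = cnj (cinner (v - proj B v) (proj B v))"
      by (rule cinner_commute)
    also have "cinner (v - proj B v) (proj B v) = (\<Sum>b\<in>B. cinner b v * cnj (cinner b (v - proj B v)))"
      by (simp add: proj_def[of B v] cinner_sum_right cinner_scaleC_right
          cinner_commute[of "v - _"])
    also have "\<dots> = 0"
      using perp[OF B] by simp
    finally have p: "cinner (proj B v) (v - proj B v) = 0"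
      by simp
    have "cinner v v = cinner (v - proj B v) v + cinner (proj B v) v"
      by (simp add: cinner_diff_left)
    also have "cinner (v - proj B v) v = cinner (v - proj B v) (v - proj B v)"
      using p cinner_commute[of "v - proj B v" "proj B v"]
      by (simp add: cinner_diff_right[of _ v])
    also have "cinner (proj B v) v = (\<Sum>b\<in>B. of_real ((cmod (cinner b v))\<^sup>2))"
      unfolding complex_norm_square
      by (subst cinner_commute)
        (simp add: proj_def cinner_sum_right cinner_scaleC_right cinner_commute[of v] mult.commute)
    finally have "complex_of_real ((norm v)\<^sup>2) =
        of_real ((\<Sum>b\<in>B. (cmod (cinner b v))\<^sup>2) + (norm (v - proj B v))\<^sup>2)"
      by (simp add: cinner_self)
    then show ?thesis
      by (simp only: of_real_eq_iff)
  qed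
  show ?thesis
  proof
    show "finite B"
      using B by (simp add: ortho_def)
    show "(\<Sum>b\<in>B. (cmod (cinner b v))\<^sup>2) \<le> (norm v)\<^sup>2" for v
      using pyth[of v] by simp
    show "(\<Sum>b\<in>B. (cmod (cinner b v))\<^sup>2) = (norm v)\<^sup>2" if "v \<in> F" for v
      using pyth[of v] F[OF that] by simp
  qed
qed

section \<open>Elementary tensors\<close>

lemma square_summable_ell2_apply: "square_summable (ell2_apply f)"
  using ell2_apply by blast

definition delta :: "'x \<Rightarrow> ('x, complex) ell2"
  where "delta x = Abs_ell2 (\<lambda>y. if y = x then 1 else 0)"

lemma delta_apply: "ell2_apply (delta x) y = (if y = x then 1 else 0)"
proof -
  have "(\<Sum>y\<in>F. (cmod (if y = x then 1 else 0))\<^sup>2) \<le> 1\<^sup>2" if "finite F" for F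
    using that by (simp add: if_distrib[of cmod] if_distrib[of "\<lambda>r. r\<^sup>2"] cong: if_cong)
  from ell2_boundI(1)[OF this] show ?thesis
    by (simp add: delta_def Abs_ell2_inverse)
qed

lemma cinner_delta: "cinner (delta x) f = ell2_apply f x"
proof -
  have "((\<lambda>y. cinner (ell2_apply (delta x) y) (ell2_apply f y)) has_sum ell2_apply f x) UNIV"
    by (rule has_sum_finite_neutralI[of "{x}"]) (auto simp: delta_apply cinner_complex_def)
  then show ?thesis
    by (simp add: cinner_ell2.rep_eq infsumI)
qed

text \<open>The remainder of \<open>f\<close> after a finite partial sum is \<open>f\<close> restricted to the complement, whose
  squared norm is a tail of the series for \<open>\<parallel>f\<parallel>\<^sup>2\<close>.\<close>

lemma has_sum_tensor_delta:
  fixes f :: "('x, 'k::chilbert_space) ell2"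
  shows "((\<lambda>x. tensor_ell2 (delta x) (ell2_apply f x)) has_sum f) UNIV"
proof -
  let ?s = "\<lambda>F. \<Sum>x\<in>F. tensor_ell2 (delta x) (ell2_apply f x)"
  have sum_apply: "ell2_apply (?s F) y = (if y \<in> F then ell2_apply f y else 0)" if "finite F" for F y
  proof -
    have "ell2_apply (?s F) y = (\<Sum>x\<in>F. if x = y then ell2_apply f y else 0)"
      using that
      by (induction F rule: finite_induct)
        (auto simp: zero_ell2.rep_eq plus_ell2.rep_eq tensor_ell2.rep_eq delta_apply scaleC_one)
    then show ?thesis
      using that by simp
  qed
  have norm_tail: "(norm (f - ?s F))\<^sup>2 = (norm f)\<^sup>2 - (\<Sum>x\<in>F. (norm (ell2_apply f x))\<^sup>2)"
    if "finite F" for F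
  proof -
    have "((\<lambda>x. (norm (ell2_apply f x))\<^sup>2) has_sum
        ((norm f)\<^sup>2 - (\<Sum>x\<in>F. (norm (ell2_apply f x))\<^sup>2))) (UNIV - F)"
      by (rule has_sum_Diff[OF norm_ell2_has_sum has_sum_finite[OF that]]) simp
    also have "?this \<longleftrightarrow> ((\<lambda>x. (norm (ell2_apply (f - ?s F) x))\<^sup>2) has_sum
        ((norm f)\<^sup>2 - (\<Sum>x\<in>F. (norm (ell2_apply f x))\<^sup>2))) UNIV"
      by (rule has_sum_cong_neutral) (auto simp: minus_ell2.rep_eq sum_apply[OF that])
    finally show ?thesis
      using has_sum_unique[OF norm_ell2_has_sum] by blast
  qed
  have "((\<lambda>F. (norm f)\<^sup>2 - (\<Sum>x\<in>F. (norm (ell2_apply f x))\<^sup>2)) \<longlongrightarrow> (norm f)\<^sup>2 - (norm f)\<^sup>2)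
      (finite_subsets_at_top UNIV)"
    using norm_ell2_has_sum[of f] unfolding has_sum_def by (intro tendsto_intros)
  moreover have "\<forall>\<^sub>F F in finite_subsets_at_top UNIV.
      (norm f)\<^sup>2 - (\<Sum>x\<in>F. (norm (ell2_apply f x))\<^sup>2) = (norm (f - ?s F))\<^sup>2"
    by (rule eventually_finite_subsets_at_top_weakI) (simp add: norm_tail)
  ultimately have "((\<lambda>F. (norm (f - ?s F))\<^sup>2) \<longlongrightarrow> (norm f)\<^sup>2 - (norm f)\<^sup>2)
      (finite_subsets_at_top UNIV)"
    by (rule Lim_transform_eventually)
  then have "((\<lambda>F. (norm (f - ?s F))\<^sup>2) \<longlongrightarrow> 0) (finite_subsets_at_top UNIV)"
    by simp
  then have "((\<lambda>F. sqrt ((norm (f - ?s F))\<^sup>2)) \<longlongrightarrow> sqrt 0) (finite_subsets_at_top UNIV)"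
    by (rule tendsto_real_sqrt)
  then have "((\<lambda>F. dist (?s F) f) \<longlongrightarrow> 0) (finite_subsets_at_top UNIV)"
    by (simp add: dist_norm norm_minus_commute)
  then show ?thesis
    unfolding has_sum_def by (rule tendsto_dist_iff[THEN iffD2])
qed

text \<open>The span of the elementary tensors is dense, by \<open>has_sum_tensor_delta\<close>.\<close>

lemma blinfun_eq_on_tensors:
  fixes S T :: "('x, 'k::chilbert_space) ell2 \<Rightarrow>\<^sub>L 'b::real_normed_vector"
  assumes "\<And>f k. S (tensor_ell2 f k) = T (tensor_ell2 f k)"
  shows "S = T"
proof (rule blinfun_eqI)
  fix f
  note has = has_sum_bounded_linear[OF blinfun.bounded_linear_right has_sum_tensor_delta[of f]]
  show "S f = T f"
    using has[of S] has[of T] by (simp add: assms has_sum_unique)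
qed

section \<open>The ampliation\<close>

text \<open>The scalar function \<open>x \<mapsto> \<langle>\<phi>, f x\<rangle>\<close>. These slices determine \<open>f\<close>, and \<open>T \<otimes> I\<close> acts on
  each of them by \<open>T\<close>.\<close>

definition slice :: "'k::chilbert_space \<Rightarrow> ('x, 'k) ell2 \<Rightarrow> ('x, complex) ell2"
  where "slice \<phi> f = Abs_ell2 (\<lambda>x. cinner \<phi> (ell2_apply f x))"

lemma slice_apply: "ell2_apply (slice \<phi> f) x = cinner \<phi> (ell2_apply f x)"
proof -
  have le: "(cmod (cinner \<phi> (ell2_apply f x)))\<^sup>2 \<le> (norm \<phi>)\<^sup>2 * (norm (ell2_apply f x))\<^sup>2" for x
    using power_mono[OF norm_cinner_le norm_ge_zero, of \<phi> "ell2_apply f x" 2]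
    by (simp add: power_mult_distrib)
  have "square_summable (\<lambda>x. cinner \<phi> (ell2_apply f x))"
    unfolding square_summable_def
  proof (rule summable_on_comparison_test)
    show "(\<lambda>x. (norm \<phi>)\<^sup>2 * (norm (ell2_apply f x))\<^sup>2) summable_on UNIV"
      using square_summable_ell2_apply[of f]
      by (intro summable_on_cmult_right) (simp add: square_summable_def)
  qed (simp_all add: le)
  then show ?thesis
    by (simp add: slice_def Abs_ell2_inverse)
qed

lemma slice_add: "slice \<phi> (f + g) = slice \<phi> f + slice \<phi> g"
  by (rule ell2_eqI) (simp add: slice_apply plus_ell2.rep_eq cinner_add_right)

lemma slice_scaleC: "slice \<phi> (c *\<^sub>C f) = c *\<^sub>C slice \<phi> f"
  by (rule ell2_eqI) (simp add: slice_apply scaleC_ell2.rep_eq cinner_scaleC_right scaleC_complex_def)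

lemma slice_tensor: "slice \<phi> (tensor_ell2 f k) = cinner \<phi> k *\<^sub>C f"
  by (rule ell2_eqI)
    (simp add: slice_apply scaleC_ell2.rep_eq tensor_ell2.rep_eq cinner_scaleC_right
      scaleC_complex_def)

lemma slices_eqI:
  assumes "\<And>\<phi>. slice \<phi> f = slice \<phi> g"
  shows "f = g"
  using assms by (intro ell2_eqI) (metis cinner_eqI slice_apply)

lemma has_sum_sum:
  fixes f :: "'b \<Rightarrow> 'a \<Rightarrow> 'c::topological_comm_monoid_add"
  assumes "\<And>b. b \<in> B \<Longrightarrow> (f b has_sum s b) A"
  shows "((\<lambda>x. \<Sum>b\<in>B. f b x) has_sum (\<Sum>b\<in>B. s b)) A"
  using assms by (induction B rule: infinite_finite_induct) (auto intro: has_sum_add)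

text \<open>The value at \<open>x\<close> of the vector to be constructed is \<open>\<Sum>y. T\<^sub>x\<^sub>y f(y)\<close>, where the matrix row
  \<open>T\<^sub>x\<^sub>y\<close> is square-summable in \<open>y\<close> because it is conjugate to \<open>T* \<delta>\<^sub>x\<close>. For the norm bound,
  evaluate \<open>\<parallel>\<cdot>\<parallel>\<^sup>2\<close> on finitely many values in an orthonormal basis of their span, and use the bound
  for \<open>T\<close> on the corresponding slices.\<close>

lemma ampliation_vector_exists:
  fixes T :: "('x, complex) ell2 \<Rightarrow>\<^sub>L ('x, complex) ell2" and f :: "('x, 'k::chilbert_space) ell2"
  assumes T: "T \<in> clin_ops"
  shows "\<exists>g. (\<forall>\<phi>. slice \<phi> g = T (slice \<phi> f)) \<and> norm g \<le> norm T * norm f"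
proof -
  define row where "row x = cadjoint T (delta x)" for x
  have T_row: "ell2_apply (T h) x = cinner (row x) h" for h x
  proof -
    have "ell2_apply (T h) x = cnj (cinner (T h) (delta x))"
      by (metis cinner_delta cinner_commute)
    then show ?thesis
      unfolding row_def by (metis cinner_cadjoint[OF T] cinner_commute)
  qed
  define g where "g x = (\<Sum>\<^sub>\<infinity>y. cnj (ell2_apply (row x) y) *\<^sub>C ell2_apply f y)" for x
  have g_slice: "cinner \<phi> (g x) = ell2_apply (T (slice \<phi> f)) x" for \<phi> x
  proof -
    have "(\<lambda>y. cnj (ell2_apply (row x) y) *\<^sub>C ell2_apply f y) summable_on UNIV"
    proof (rule abs_summable_summable, rule summable_on_comparison_test)
      show "(\<lambda>y. (cmod (ell2_apply (row x) y))\<^sup>2 + (norm (ell2_apply f y))\<^sup>2) summable_on UNIV"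
        using square_summable_ell2_apply[of f] square_summable_ell2_apply[of "row x"]
        by (intro summable_on_add) (auto simp: square_summable_def)
      show "norm (cnj (ell2_apply (row x) y) *\<^sub>C ell2_apply f y)
          \<le> (cmod (ell2_apply (row x) y))\<^sup>2 + (norm (ell2_apply f y))\<^sup>2" for y
        using sum_squares_bound[of "cmod (ell2_apply (row x) y)" "norm (ell2_apply f y)"]
          mult_nonneg_nonneg[OF norm_ge_zero[of "ell2_apply (row x) y"] norm_ge_zero[of "ell2_apply f y"]]
        by (simp add: norm_scaleC del: mult_nonneg_nonneg)
    qed auto
    from has_sum_bounded_linear[OF bounded_linear_cinner_right has_sum_infsum[OF this], of \<phi>]
    have "cinner \<phi> (g x) = (\<Sum>\<^sub>\<infinity>y. cinner \<phi> (cnj (ell2_apply (row x) y) *\<^sub>C ell2_apply f y))"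
      by (simp add: g_def infsumI)
    also have "\<dots> = cinner (row x) (slice \<phi> f)"
      by (simp add: cinner_ell2.rep_eq slice_apply cinner_scaleC_right cinner_complex_def)
    finally show ?thesis
      by (simp add: T_row)
  qed
  have bound: "(\<Sum>x\<in>F. (norm (g x))\<^sup>2) \<le> (norm T * norm f)\<^sup>2" if F: "finite F" for F
  proof -
    obtain B where B: "finite B" "\<And>v. (\<Sum>b\<in>B. (cmod (cinner b v))\<^sup>2) \<le> (norm v)\<^sup>2"
      "\<And>v. v \<in> g ` F \<Longrightarrow> (\<Sum>b\<in>B. (cmod (cinner b v))\<^sup>2) = (norm v)\<^sup>2"
      using finite_Parseval[of "g ` F"] F by blast
    have "(\<Sum>x\<in>F. (norm (g x))\<^sup>2) = (\<Sum>x\<in>F. \<Sum>b\<in>B. (cmod (ell2_apply (T (slice b f)) x))\<^sup>2)"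
      by (rule sum.cong) (auto simp: B(3)[symmetric] g_slice)
    also have "\<dots> = (\<Sum>b\<in>B. \<Sum>x\<in>F. (cmod (ell2_apply (T (slice b f)) x))\<^sup>2)"
      by (rule sum.swap)
    also have "\<dots> \<le> (\<Sum>b\<in>B. (norm T * norm (slice b f))\<^sup>2)"
      by (intro sum_mono order_trans[OF norm_ell2_finite_le[OF F]] power_mono norm_blinfun) auto
    also have "\<dots> = (norm T)\<^sup>2 * (\<Sum>b\<in>B. (norm (slice b f))\<^sup>2)"
      by (simp add: power_mult_distrib sum_distrib_left)
    also have "\<dots> \<le> (norm T)\<^sup>2 * (norm f)\<^sup>2"
    proof (rule mult_left_mono, rule has_sum_mono)
      show "((\<lambda>x. \<Sum>b\<in>B. (cmod (ell2_apply (slice b f) x))\<^sup>2) has_sum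
          (\<Sum>b\<in>B. (norm (slice b f))\<^sup>2)) UNIV"
        by (intro has_sum_sum norm_ell2_has_sum)
      show "((\<lambda>x. (norm (ell2_apply f x))\<^sup>2) has_sum (norm f)\<^sup>2) UNIV"
        by (rule norm_ell2_has_sum)
    qed (auto simp: slice_apply B(2))
    finally show ?thesis
      by (simp add: power_mult_distrib)
  qed
  note g = ell2_boundI[OF bound]
  have "slice \<phi> (Abs_ell2 g) = T (slice \<phi> f)" for \<phi>
    by (rule ell2_eqI) (simp add: slice_apply Abs_ell2_inverse g g_slice)
  then show ?thesis
    using g(2) by (intro exI[of _ "Abs_ell2 g"]) simp
qed

text \<open>The slices determine the vectors just constructed, so these depend linearly on \<open>f\<close>; density of
  the elementary tensors identifies the resulting operator with the one described by \<open>ampliation\<close>.\<close>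

lemma ampliation:
  fixes T :: "('x, complex) ell2 \<Rightarrow>\<^sub>L ('x, complex) ell2"
  defines "A \<equiv> ampliation T :: ('x, 'k::chilbert_space) ell2 \<Rightarrow>\<^sub>L ('x, 'k) ell2"
  assumes T: "T \<in> clin_ops"
  shows "A \<in> clin_ops" "A (tensor_ell2 f k) = tensor_ell2 (T f) k" "norm A \<le> norm T"
proof -
  obtain S where S: "\<And>\<phi> f. slice \<phi> (S f) = T (slice \<phi> f)"
    and bound: "\<And>f. norm (S f) \<le> norm T * norm (f :: ('x, 'k) ell2)"
    using ampliation_vector_exists[OF T] by metis
  have add: "S (f + g) = S f + S g" for f g
    by (rule slices_eqI) (simp add: S slice_add blinfun.add_right)
  have scale: "S (c *\<^sub>C f) = c *\<^sub>C S f" for c f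
    by (rule slices_eqI) (simp add: S slice_scaleC clin_opsD[OF T])
  have "bounded_linear S"
    by (rule bounded_linear_intro[of _ "norm T"])
      (use bound in \<open>simp_all add: add scaleR_scaleC scale mult.commute\<close>)
  then obtain S' :: "('x, 'k) ell2 \<Rightarrow>\<^sub>L ('x, 'k) ell2" where S': "\<And>f. S' f = S f"
    by (metis bounded_linear_Blinfun_apply)
  have tensor: "S' (tensor_ell2 f k) = tensor_ell2 (T f) k" for f k
    by (rule slices_eqI) (simp add: S' S slice_tensor clin_opsD[OF T])
  have clin: "S' \<in> clin_ops"
    by (simp add: clin_ops_def S' scale)
  have "A = S'"
    unfolding A_def ampliation_def
  proof (rule the_equality)
    show "S' \<in> clin_ops \<and> (\<forall>f k. S' (tensor_ell2 f k) = tensor_ell2 (T f) k)"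
      using clin tensor by blast
  next
    fix U :: "('x, 'k) ell2 \<Rightarrow>\<^sub>L ('x, 'k) ell2"
    assume "U \<in> clin_ops \<and> (\<forall>f k. U (tensor_ell2 f k) = tensor_ell2 (T f) k)"
    then show "U = S'"
      by (intro blinfun_eq_on_tensors) (simp add: tensor)
  qed
  moreover have "norm S' \<le> norm T"
    by (rule norm_blinfun_bound) (simp_all add: S' bound)
  ultimately show "A \<in> clin_ops" "A (tensor_ell2 f k) = tensor_ell2 (T f) k" "norm A \<le> norm T"
    using clin tensor by simp_all
qed

text \<open>\<open>T \<mapsto> T \<otimes> I\<close> is multiplicative and unital, as can be seen on elementary tensors.\<close>

lemma op_inverse_ampliation:
  assumes T: "T \<in> clin_ops" and R: "op_inverse R (T - cmul z)"
  shows "op_inverse (ampliation R) (ampliation T - cmul z ::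
    ('x, 'k::chilbert_space) ell2 \<Rightarrow>\<^sub>L ('x, 'k) ell2)"
proof -
  have R_clin: "R \<in> clin_ops" and left: "R (T f - z *\<^sub>C f) = f" and right: "T (R f) - z *\<^sub>C R f = f"
    for f
    using R by (simp_all add: op_inverse_def blinfun.bilinear_simps)
  let ?R = "ampliation R :: ('x, 'k) ell2 \<Rightarrow>\<^sub>L ('x, 'k) ell2"
  let ?T = "ampliation T - cmul z :: ('x, 'k) ell2 \<Rightarrow>\<^sub>L ('x, 'k) ell2"
  have tensor: "?T (tensor_ell2 f k) = tensor_ell2 (T f - z *\<^sub>C f) k" for f k
    by (rule ell2_eqI)
      (simp add: blinfun.bilinear_simps ampliation(2)[OF T] minus_ell2.rep_eq scaleC_ell2.rep_eq
        tensor_ell2.rep_eq scaleC_scaleC scaleC_complex_def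
        scaleC_diff_left)
  have "?R o\<^sub>L ?T = id_blinfun"
    by (rule blinfun_eq_on_tensors) (simp add: tensor ampliation(2)[OF R_clin] left)
  moreover have "?T o\<^sub>L ?R = id_blinfun"
    by (rule blinfun_eq_on_tensors) (simp add: tensor ampliation(2)[OF R_clin] right)
  ultimately have "?R (?T f) = f" "?T (?R f) = f" for f
    by (metis blinfun_apply_blinfun_compose blinfun_apply_id_blinfun id_apply)+
  then show ?thesis
    by (simp add: op_inverse_def ampliation(1)[OF R_clin])
qed

section \<open>Multiplication operators\<close>

lemma clin_ops_mult_op:
  assumes "bounded (range V)" "\<And>x. V x \<in> clin_ops"
  shows "mult_op V \<in> clin_ops"
  unfolding clin_ops_def mem_Collect_eq
proof (intro allI)
  fix c f
  show "mult_op V (c *\<^sub>C f) = c *\<^sub>C mult_op V f"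
  proof (rule ell2_eqI)
    fix x
    show "ell2_apply (mult_op V (c *\<^sub>C f)) x = ell2_apply (c *\<^sub>C mult_op V f) x"
      unfolding scaleC_ell2.rep_eq mult_op_apply[OF assms(1)] clin_opsD[OF assms(2)] ..
  qed
qed

lemma norm_mult_op_le:
  fixes V :: "'x \<Rightarrow> 'k::chilbert_space \<Rightarrow>\<^sub>L 'k"
  assumes V: "\<And>x. norm (V x) \<le> b"
  shows "norm (mult_op V) \<le> b"
proof (rule norm_blinfun_bound)
  show "0 \<le> b"
    using order_trans[OF norm_ge_zero V] .
  fix f :: "('x, 'k) ell2"
  have bdd: "bounded (range V)"
    using V by (auto simp: bounded_iff)
  have "(norm (mult_op V f))\<^sup>2 \<le> b\<^sup>2 * (norm f)\<^sup>2"
  proof (rule has_sum_mono[OF norm_ell2_has_sum has_sum_cmult_right[OF norm_ell2_has_sum]])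
    fix x
    have "norm (V x (ell2_apply f x)) \<le> b * norm (ell2_apply f x)"
      by (intro order_trans[OF norm_blinfun] mult_right_mono V) simp
    from power_mono[OF this norm_ge_zero, of 2]
    show "(norm (ell2_apply (mult_op V f) x))\<^sup>2 \<le> b\<^sup>2 * (norm (ell2_apply f x))\<^sup>2"
      by (simp add: mult_op_apply[OF bdd] power_mult_distrib)
  qed
  then have "(norm (mult_op V f))\<^sup>2 \<le> (b * norm f)\<^sup>2"
    by (simp add: power_mult_distrib)
  then show "norm (mult_op V f) \<le> b * norm f"
    by (rule power2_le_imp_le) (simp add: \<open>0 \<le> b\<close>)
qed

lemma op_inverse_mult_op:
  fixes V R :: "'x \<Rightarrow> 'k::chilbert_space \<Rightarrow>\<^sub>L 'k"
  assumes V: "bounded (range V)" and R: "bounded (range R)"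
    and inv: "\<And>x. op_inverse (R x) (V x - cmul z)"
  shows "op_inverse (mult_op R) (mult_op V - cmul z)"
  unfolding op_inverse_def
proof (intro conjI allI)
  show "mult_op R \<in> clin_ops"
    using inv by (intro clin_ops_mult_op R) (simp add: op_inverse_def)
  fix f :: "('x, 'k) ell2"
  show "mult_op R ((mult_op V - cmul z) f) = f"
    by (rule ell2_eqI)
      (use inv in \<open>simp add: op_inverse_def mult_op_apply V R blinfun.diff_left
        minus_ell2.rep_eq scaleC_ell2.rep_eq\<close>)
  show "(mult_op V - cmul z) (mult_op R f) = f"
    by (rule ell2_eqI)
      (use inv in \<open>simp add: op_inverse_def mult_op_apply V R blinfun.diff_left
        minus_ell2.rep_eq scaleC_ell2.rep_eq\<close>)
qed

section \<open>The two spectral inclusions\<close>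

text \<open>The radius is the distance from \<open>z\<close> to \<open>E\<close>. Being attained, it exceeds \<open>r\<close> strictly. If \<open>E\<close>
  is empty, any radius will do.\<close>

lemma ball_disjoint_closed:
  fixes E :: "complex set"
  assumes "closed E" "z \<notin> E + cball 0 r" "0 \<le> r"
  obtains d where "r < d" "ball z d \<inter> E = {}"
proof (cases "E = {}")
  case True
  then show ?thesis
    using that[of "r + 1"] by simp
next
  case False
  obtain y where y: "y \<in> E" "infdist z E = dist z y"
    using infdist_attains_inf[OF assms(1) False] by blast
  show ?thesis
  proof
    have "z - y \<notin> cball 0 r"
    proof
      assume "z - y \<in> cball 0 r"
      then have "y + (z - y) \<in> E + cball 0 r"
        using y(1) by (rule set_plus_intro[rotated])
      then show False
        using assms(2) by simp
    qed
    then show "r < infdist z E"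
      by (simp add: y(2) dist_norm norm_minus_commute)
    show "ball z (infdist z E) \<inter> E = {}"
      using infdist_le[of _ E z] by fastforce
  qed
qed

theorem theorem4:
  fixes G :: "('g, 'm) monoid_scheme"
    and \<phi> :: "'g \<Rightarrow> 'x::countable \<Rightarrow> 'x"
    and H\<^sub>0 :: "('x, complex) ell2 \<Rightarrow>\<^sub>L ('x, complex) ell2"
    and M :: "('k::chilbert_space \<Rightarrow>\<^sub>L 'k) set"
    and V :: "'x \<Rightarrow> 'k \<Rightarrow>\<^sub>L 'k"
    and H :: "('x, 'k) ell2 \<Rightarrow>\<^sub>L ('x, 'k) ell2"
    and E :: "complex set"
    and e \<mu> :: real
  assumes "group_action G UNIV \<phi>"
    and "H\<^sub>0 \<in> clin_ops"
    and "\<And>g. g \<in> carrier G \<Longrightarrow> H\<^sub>0 o\<^sub>L translation G \<phi> g = translation G \<phi> g o\<^sub>L H\<^sub>0"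
    and "M \<subseteq> clin_ops" and "closed M" and "bounded M"
    and "pseudo_ergodic G \<phi> M V"
    and "H = ampliation H\<^sub>0 + mult_op V"
    and "E = Spec H\<^sub>0"
    and "e = norm H\<^sub>0"
    and "\<mu> = (SUP A\<in>M. norm A)"
  shows "((\<forall>A\<in>M. normal_op A) \<longrightarrow> Spec H \<subseteq> Spec_set M + cball 0 e) \<and>
    (normal_op H\<^sub>0 \<longrightarrow> Spec H \<subseteq> E + cball 0 \<mu>)"
proof (intro conjI impI subsetI)
  note H\<^sub>0 = \<open>H\<^sub>0 \<in> clin_ops\<close>
  have VM: "V x \<in> M" for x
    using \<open>pseudo_ergodic G \<phi> M V\<close> by (auto simp: pseudo_ergodic_def)
  then have V_clin: "V x \<in> clin_ops" for x
    using \<open>M \<subseteq> clin_ops\<close> by blast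
  have "bounded (range V)"
    using VM by (intro bounded_subset[OF \<open>bounded M\<close>]) auto
  define A where "A = (ampliation H\<^sub>0 :: ('x, 'k) ell2 \<Rightarrow>\<^sub>L ('x, 'k) ell2)"
  have A: "A \<in> clin_ops" "norm A \<le> e"
    unfolding A_def \<open>e = norm H\<^sub>0\<close> by (rule ampliation[OF H\<^sub>0])+
  {
    fix z assume normal: "\<forall>A\<in>M. normal_op A" and "z \<in> Spec H"
    show "z \<in> Spec_set M + cball 0 e"
    proof (rule ccontr)
      assume "z \<notin> Spec_set M + cball 0 e"
      then obtain d where d: "e < d" and disc: "ball z d \<inter> Spec_set M = {}"
        using ball_disjoint_closed[of "Spec_set M" z e] \<open>e = norm H\<^sub>0\<close>
        by (auto simp: Spec_set_def)
      have "0 < d"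
        using d \<open>e = norm H\<^sub>0\<close> norm_ge_zero[of H\<^sub>0] by linarith
      have disc_V: "ball z d \<inter> Spec (V x) = {}" for x
        using disc VM[of x] closure_subset[of "\<Union>A\<in>M. Spec A"] unfolding Spec_set_def by blast
      then have "z \<notin> Spec (V x)" for x
        using \<open>0 < d\<close> by (metis centre_in_ball disjoint_iff)
      then obtain R where R: "\<And>x. op_inverse (R x) (V x - cmul z)"
        unfolding not_in_Spec_iff by metis
      have norm_R: "norm (R x) \<le> 1 / d" for x
        using normal VM
        by (intro norm_resolvent_le[OF V_clin paranormal_normal_shift[OF V_clin] R \<open>0 < d\<close> disc_V])
          blast
      have "bounded (range R)"
        using norm_R by (auto simp: bounded_iff)
      then have inv: "op_inverse (mult_op R) (mult_op V - cmul z)"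
        by (rule op_inverse_mult_op[OF \<open>bounded (range V)\<close> _ R])
      have "norm (mult_op R) * norm A \<le> (1 / d) * e"
        using A(2) norm_mult_op_le[of R, OF norm_R] \<open>0 < d\<close> by (intro mult_mono) auto
      also have "\<dots> < 1"
        using d \<open>0 < d\<close> by (simp add: field_simps)
      finally obtain S where "op_inverse S (mult_op V - cmul z + A)"
        using op_inverse_perturb[OF inv A(1)] by blast
      moreover have "mult_op V - cmul z + A = H - cmul z"
        using \<open>H = ampliation H\<^sub>0 + mult_op V\<close> by (simp add: A_def)
      ultimately show False
        using \<open>z \<in> Spec H\<close> not_in_Spec_iff[of z H] by auto
    qed
  }
  {
    fix z assume normal: "normal_op H\<^sub>0" and "z \<in> Spec H"
    have "bdd_above (norm ` M)"
      using \<open>bounded M\<close> by (auto simp: bounded_iff bdd_above_def)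
    then have "norm (V x) \<le> \<mu>" for x
      unfolding \<open>\<mu> = (SUP A\<in>M. norm A)\<close> by (intro cSUP_upper VM)
    then have norm_V: "norm (mult_op V) \<le> \<mu>"
      by (rule norm_mult_op_le)
    then have "0 \<le> \<mu>"
      using norm_ge_zero order_trans by blast
    show "z \<in> E + cball 0 \<mu>"
    proof (rule ccontr)
      assume "z \<notin> E + cball 0 \<mu>"
      then obtain d where d: "\<mu> < d" and disc: "ball z d \<inter> Spec H\<^sub>0 = {}"
        using ball_disjoint_closed[OF closed_Spec] \<open>0 \<le> \<mu>\<close> \<open>E = Spec H\<^sub>0\<close> by blast
      have "0 < d"
        using d \<open>0 \<le> \<mu>\<close> by simp
      then have "z \<notin> Spec H\<^sub>0"
        using disc by (metis centre_in_ball disjoint_iff)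
      then obtain R where R: "op_inverse R (H\<^sub>0 - cmul z)"
        unfolding not_in_Spec_iff by blast
      then have "R \<in> clin_ops"
        by (simp add: op_inverse_def)
      define R' where "R' = (ampliation R :: ('x, 'k) ell2 \<Rightarrow>\<^sub>L ('x, 'k) ell2)"
      have inv: "op_inverse R' (A - cmul z)"
        unfolding R'_def A_def by (rule op_inverse_ampliation[OF H\<^sub>0 R])
      have "norm R' \<le> 1 / d"
        unfolding R'_def using ampliation(3)[OF \<open>R \<in> clin_ops\<close>]
          norm_resolvent_le[OF H\<^sub>0 paranormal_normal_shift[OF H\<^sub>0 normal] R \<open>0 < d\<close> disc]
        by (rule order_trans)
      then have "norm R' * norm (mult_op V) \<le> (1 / d) * \<mu>"
        using norm_V \<open>0 < d\<close> by (intro mult_mono) auto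
      also have "\<dots> < 1"
        using d \<open>0 < d\<close> by (simp add: field_simps)
      finally obtain S where "op_inverse S (A - cmul z + mult_op V)"
        using op_inverse_perturb[OF inv clin_ops_mult_op[OF \<open>bounded (range V)\<close> V_clin]] by blast
      moreover have "A - cmul z + mult_op V = H - cmul z"
        using \<open>H = ampliation H\<^sub>0 + mult_op V\<close> by (simp add: A_def)
      ultimately show False
        using \<open>z \<in> Spec H\<close> not_in_Spec_iff[of z H] by auto
    qed
  }
qed

end
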